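(* Let $\Gamma,\tilde\Gamma$ be groups and $\alpha\in\mathrm{Aut}(\Gamma)$, $\tilde\alpha\in\mathrm{Aut}(\tilde\Gamma)$. Let $G=\bigoplus_{\mathbf{Q}_2}\Gamma\rtimes_\alpha V$ and $\tilde G=\bigoplus_{\mathbf{Q}_2}\tilde\Gamma\rtimes_{\tilde\alpha} V$ be the associated fraction groups. Then $G$ and $\tilde G$ are isomorphic if and only if there exist a group isomorphism $\beta:\Gamma\to\tilde\Gamma$ and $h\in\tilde\Gamma$ such that $\tilde\alpha=\mathrm{ad}(h)\circ\beta\circ\alpha\circ\beta^{-1}$, where $\mathrm{ad}(h)(g)=hgh^{-1}$.
   Context: Cantor space is $\mathfrak C=\{0,1\}^{\mathbf N}$ with the product topology. For a finite word $m$ in $\{0,1\}$ let $C_m=\{m\cdot x: x\in\{0,1\}^{\mathbf N}\}$ (concatenation). Thompson's group $V$ is the group of homeomorphisms $v$ of $\mathfrak C$ for which there exist two partitions $\mathfrak C=\bigsqcup_{k=1}^n C_{m_k}=\bigsqcup_{k=1}^n C_{m'_k}$ with $v(m_k\cdot x)=m'_k\cdot x$ for all $k$ and all $x$. For such $v$ and $x\in C_{m_k}$, the slope is $v'(x)=2^{|m_k|-|m'_k|}$ (independent of choices); it satisfies the chain rule $(vw)'(x)=v'(wx)w'(x)$. $\mathbf{Q}_2\subset\mathfrak C$ is the set of sequences that are eventually $0$ (identified with the dyadic rationals of $[0,1)$ via $x\mapsto\sum_{n\ge1}x_n2^{-n}$); it is $V$-invariant. For a group $\Gamma$ and $\alpha\in\mathrm{Aut}(\Gamma)$,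 $\bigoplus_{\mathbf{Q}_2}\Gamma$ is the group of finitely supported maps $\mathbf{Q}_2\to\Gamma$, and $V$ acts on it by $(v\cdot a)(x)=\alpha^{\log_2 v'(v^{-1}x)}(a(v^{-1}x))$; the semidirect product $\bigoplus_{\mathbf{Q}_2}\Gamma\rtimes_\alpha V$ is (isomorphic to) the fraction group given by Jones' technology from the covariant monoidal functor from binary forests to groups sending the one-caret tree to the morphism $\Gamma\to\Gamma\oplus\Gamma$, $g\mapsto(\alpha(g),e)$. *)

theory Defs
  imports "HOL-Algebra.Algebra"
begin

type_synonym cantor = "nat \<Rightarrow> bool"

definition concat_word :: "bool list \<Rightarrow> cantor \<Rightarrow> cantor" (infixr "@@" 65) where
  "m @@ x = (\<lambda>n. if n < length m then m ! n else x (n - length m))"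

definition cyl :: "bool list \<Rightarrow> cantor set" where
  "cyl m = {m @@ x | x. True}"

definition is_cyl_partition :: "bool list list \<Rightarrow> bool" where
  "is_cyl_partition ms \<longleftrightarrow> (\<forall>x. \<exists>!k. k < length ms \<and> x \<in> cyl (ms ! k))"

definition thompsonV :: "(cantor \<Rightarrow> cantor) set" where
  "thompsonV = {v. bij v \<and> (\<exists>ms ms'. length ms = length ms' \<and> is_cyl_partition ms \<and>
      is_cyl_partition ms' \<and> (\<forall>k < length ms. \<forall>x. v (ms ! k @@ x) = ms' ! k @@ x))}"

text \<open>log_2 of the slope v'(x) = 2^(|m| - |m'|).\<close>
definition log_slope :: "(cantor \<Rightarrow> cantor) \<Rightarrow> cantor \<Rightarrow> int" where
  "log_slope v x = (THE d. \<exists>m m'. x \<in> cyl m \<and> (\<forall>y. v (m @@ y) = m' @@ y)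
                              \<and> d = int (length m) - int (length m'))"

text \<open>Dyadic rationals: eventually-zero sequences.\<close>
definition Q2 :: "cantor set" where
  "Q2 = {x. finite {n. x n}}"

definition aut_pow :: "('a, 'm) monoid_scheme \<Rightarrow> ('a \<Rightarrow> 'a) \<Rightarrow> int \<Rightarrow> 'a \<Rightarrow> 'a" where
  "aut_pow G \<alpha> k = (if k \<ge> 0 then \<alpha> ^^ nat k else (inv_into (carrier G) \<alpha>) ^^ nat (- k))"

definition fin_supp :: "('a, 'm) monoid_scheme \<Rightarrow> (cantor \<Rightarrow> 'a) set" where
  "fin_supp G = {a. (\<forall>x \<in> Q2. a x \<in> carrier G) \<and> (\<forall>x. x \<notin> Q2 \<longrightarrow> a x = \<one>\<^bsub>G\<^esub>)
                     \<and> finite {x. a x \<noteq> \<one>\<^bsub>G\<^esub>}}"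

definition V_act :: "('a, 'm) monoid_scheme \<Rightarrow> ('a \<Rightarrow> 'a) \<Rightarrow> (cantor \<Rightarrow> cantor)
                      \<Rightarrow> (cantor \<Rightarrow> 'a) \<Rightarrow> (cantor \<Rightarrow> 'a)" where
  "V_act G \<alpha> v a = (\<lambda>x. aut_pow G \<alpha> (log_slope v (inv_into UNIV v x)) (a (inv_into UNIV v x)))"

definition semidirect_QV :: "('a, 'm) monoid_scheme \<Rightarrow> ('a \<Rightarrow> 'a)
      \<Rightarrow> ((cantor \<Rightarrow> 'a) \<times> (cantor \<Rightarrow> cantor)) monoid" where
  "semidirect_QV G \<alpha> = \<lparr> carrier = fin_supp G \<times> thompsonV,
     monoid.mult = (\<lambda>(a, v) (b, w). (\<lambda>x. a x \<otimes>\<^bsub>G\<^esub> V_act G \<alpha> v b x, v \<circ> w)),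
     one = (\<lambda>_. \<one>\<^bsub>G\<^esub>, id) \<rparr>"

end

theory Submission
  imports Defs
begin

text \<open>
  If \<open>\<alpha>' = ad(h) \<circ> \<beta> \<circ> \<alpha> \<circ> \<beta>\<inverse>\<close>, the powers of \<open>\<alpha>'\<close> and \<open>\<beta> \<circ> \<alpha> \<circ> \<beta>\<inverse>\<close> differ by inner automorphisms given by a
  cocycle \<open>k\<close> of the integers. Composed with the logarithm of the slope, \<open>k\<close> becomes a cocycle of \<open>V\<close>
  whose values need not be finitely supported; but the logarithmic slope is, off finitely many
  points, the coboundary of the position of the last digit \<open>1\<close>, and correcting by this coboundary
  gives an isomorphism.

  Conversely let \<open>\<theta>\<close> be an isomorphism. Conjugates of \<open>\<Gamma>\<^sub>x\<close> (the summand at \<open>x\<close>) that move \<open>x\<close> commute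
  with \<open>\<Gamma>\<^sub>x\<close>, which the conjugates of a nontrivial element of \<open>V\<close> do not, so \<open>\<theta>\<close> respects the direct
  sums and induces an automorphism \<open>\<phi>\<close> of \<open>V\<close>. An element \<open>g \<noteq> 1\<close> of \<open>\<Gamma>\<^sub>x\<close> commutes with the elements of \<open>V\<close> that
  fix \<open>x\<close> with slope one, so \<open>\<phi>\<close> makes these permute the finite support of \<open>\<theta>(g)\<close>; those having roots of
  every order then fix it pointwise. As \<open>V\<close> is highly transitive on \<open>Q2\<close>, this yields a bijection
  \<open>\<sigma>\<close> of \<open>Q2\<close> with \<open>\<phi>(v) = \<sigma> v \<sigma>\<inverse>\<close>. Supports of elements of \<open>V\<close> form a basis of the topology, so \<open>\<sigma>\<close> is a
  homeomorphism; contracting and expanding fixed points are therefore preserved, and with them the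
  slope at fixed points. It follows that \<open>\<theta>(\<Gamma>\<^sub>x) = \<Gamma>'\<^sub>\<sigma>\<^sub>x\<close>, and conjugation by an element fixing \<open>x\<close> with slope
  two identifies \<open>\<alpha>\<close> with \<open>\<alpha>'\<close> up to an inner automorphism.
\<close>

section \<open>Elements of V and their slopes\<close>

abbreviation vinv :: "(cantor \<Rightarrow> cantor) \<Rightarrow> cantor \<Rightarrow> cantor" where
  "vinv v \<equiv> inv_into UNIV v"

definition acts_by :: "(cantor \<Rightarrow> cantor) \<Rightarrow> bool list \<Rightarrow> bool list \<Rightarrow> bool" where
  "acts_by v m m' \<longleftrightarrow> (\<forall>y. v (m @@ y) = m' @@ y)"

definition prefix_word :: "nat \<Rightarrow> cantor \<Rightarrow> bool list" where
  "prefix_word n x = map x [0..<n]"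

lemma finite_words: "finite {m :: bool list. length m = N}"
  by (rule finite_subset [OF _ finite_lists_length_eq [OF finite_UNIV, of N]]) blast

lemma length_prefix_word [simp]: "length (prefix_word n x) = n"
  by (simp add: prefix_word_def)

lemma concat_word_Nil [simp]: "[] @@ x = x"
  by (simp add: concat_word_def)

lemma concat_word_append: "(m @ p) @@ y = m @@ (p @@ y)"
  by (auto simp: concat_word_def fun_eq_iff nth_append)

lemma concat_word_less: "i < length m \<Longrightarrow> (m @@ y) i = m ! i"
  by (simp add: concat_word_def)

lemma concat_word_add: "(m @@ y) (length m + i) = y i"
  by (simp add: concat_word_def)

lemma prefix_word_split: "x = prefix_word n x @@ (\<lambda>i. x (n + i))"
  by (auto simp: concat_word_def prefix_word_def fun_eq_iff)

lemma in_cyl_prefix_word: "x \<in> cyl (prefix_word n x)"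
  unfolding cyl_def mem_Collect_eq by (intro exI conjI TrueI, rule prefix_word_split)

lemma concat_word_eq_iff:
  assumes "length m = length n"
  shows "m @@ y = n @@ z \<longleftrightarrow> m = n \<and> y = z"
proof
  assume eq: "m @@ y = n @@ z"
  have "m = n"
    by (rule nth_equalityI) (use assms eq in \<open>metis concat_word_less\<close>)+
  moreover have "y = z"
    by (rule ext) (metis assms eq concat_word_add)
  ultimately show "m = n \<and> y = z" ..
qed auto

text \<open>Cylinders that meet are nested; this is how two local rules at a common point are
  compared.\<close>

lemma concat_word_prefixE:
  assumes "m @@ y = q @@ z" "length m \<le> length q"
  obtains r where "q = m @ r" "y = r @@ z"
proof -
  have "q @@ z = take (length m) q @@ (drop (length m) q @@ z)"
    by (metis append_take_drop_id concat_word_append)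
  then have "m = take (length m) q \<and> y = drop (length m) q @@ z"
    using assms by (subst concat_word_eq_iff [symmetric]) auto
  then show ?thesis
    using that [of "drop (length m) q"] by (metis append_take_drop_id)
qed

text \<open>Otherwise \<open>b = a @ r\<close> with \<open>r\<close> nonempty, and cancelling
  \<open>a\<close> leaves \<open>t = r @@ t\<close> for every \<open>t\<close>. The constant
  sequence opposite to the first letter of \<open>r\<close> refutes this.\<close>

lemma concat_word_eq_imp_length_le:
  assumes "\<And>t. a @@ t = b @@ t"
  shows "length b \<le> length a"
proof (rule ccontr)
  assume "\<not> length b \<le> length a"
  then have "length a < length b" by simp
  with assms [of "\<lambda>_. False"] obtain r where r: "b = a @ r"
    by (metis concat_word_prefixE less_imp_le)
  have "t = r @@ t" for t
    using assms [of t] by (metis r concat_word_append concat_word_eq_iff)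
  from fun_cong [OF this [of "\<lambda>_. \<not> r ! 0"], of 0] \<open>length a < length b\<close> r
  show False by (simp add: concat_word_def)
qed

lemma concat_word_eq_imp_length:
  "(\<And>t. a @@ t = b @@ t) \<Longrightarrow> length a = length b"
  by (metis concat_word_eq_imp_length_le le_antisym)

lemma acts_by_append: "acts_by v m m' \<Longrightarrow> acts_by v (m @ r) (m' @ r)"
  by (simp add: acts_by_def concat_word_append)

text \<open>Of two words with a common point one extends the other by some \<open>r\<close>, and the
  rule on the longer word is the rule on the shorter one followed by \<open>r\<close>, so both
  lengths grow equally. This makes the \<open>THE\<close> in \<open>log_slope\<close> well
  defined.\<close>

lemma acts_by_slope_unique:
  assumes "acts_by v m m'" "acts_by v n n'" "m @@ y = n @@ z"
  shows "int (length m) - int (length m') = int (length n) - int (length n')"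
proof -
  have *: "int (length m) - int (length m') = int (length n) - int (length n')"
    if "acts_by v m m'" "acts_by v n n'" "m @@ y = n @@ z" "length m \<le> length n" for m m' n n' y z
  proof -
    from that obtain r where r: "n = m @ r" by (metis concat_word_prefixE)
    have "(m' @ r) @@ t = n' @@ t" for t
      using that r by (metis acts_by_def acts_by_append)
    from concat_word_eq_imp_length [OF this] r show ?thesis by simp
  qed
  show ?thesis
    using * [OF assms] * [OF assms(2,1) assms(3) [symmetric]] by fastforce
qed

lemma log_slope_eq:
  assumes "acts_by v m m'"
  shows "log_slope v (m @@ y) = int (length m) - int (length m')"
  unfolding log_slope_def
proof (rule the_equality)
  show "\<exists>n n'. m @@ y \<in> cyl n \<and> (\<forall>y. v (n @@ y) = n' @@ y) \<and>
          int (length m) - int (length m') = int (length n) - int (length n')"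
    using assms by (auto simp: acts_by_def cyl_def)
next
  fix d
  assume "\<exists>n n'. m @@ y \<in> cyl n \<and> (\<forall>y. v (n @@ y) = n' @@ y) \<and>
          d = int (length n) - int (length n')"
  then obtain n n' z where "m @@ y = n @@ z" "acts_by v n n'" "d = int (length n) - int (length n')"
    by (auto simp: acts_by_def cyl_def)
  then show "d = int (length m) - int (length m')"
    using acts_by_slope_unique [OF assms] by metis
qed

text \<open>A common refinement of the two partitions by words of one fixed length.\<close>

lemma thompsonV_iff:
  "v \<in> thompsonV \<longleftrightarrow> bij v \<and> (\<exists>N. \<forall>m. length m = N \<longrightarrow> (\<exists>m'. acts_by v m m'))"
proof
  assume "v \<in> thompsonV"
  then obtain ms ms' where bij: "bij v" and len: "length ms = length ms'"
    and part: "is_cyl_partition ms" and v: "\<And>k x. k < length ms \<Longrightarrow> v (ms ! k @@ x) = ms' ! k @@ x"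
    unfolding thompsonV_def by blast
  \<comment> \<open>The sum of all lengths dominates each of them, so a word this long extends a
    member of the partition and inherits its rule.\<close>
  have "\<exists>m'. acts_by v m m'" if m: "length m = sum_list (map length ms)" for m
  proof -
    obtain k z where k: "k < length ms" "m @@ (\<lambda>_. False) = ms ! k @@ z"
      using part unfolding is_cyl_partition_def cyl_def by blast
    have "length (ms ! k) \<le> length m"
      unfolding m by (rule member_le_sum_list) (use k in auto)
    with k obtain r where "m = ms ! k @ r" by (metis concat_word_prefixE)
    then have "acts_by v m (ms' ! k @ r)"
      using k(1) v by (simp add: acts_by_def concat_word_append)
    then show ?thesis ..
  qed
  with bij show "bij v \<and> (\<exists>N. \<forall>m. length m = N \<longrightarrow> (\<exists>m'. acts_by v m m'))" by blast
next
  assume "bij v \<and> (\<exists>N. \<forall>m. length m = N \<longrightarrow> (\<exists>m'. acts_by v m m'))"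
  then obtain N where bij: "bij v" and N: "\<And>m. length m = N \<Longrightarrow> \<exists>m'. acts_by v m m'" by blast
  define f where "f m = (SOME m'. acts_by v m m')" for m
  have f: "acts_by v m (f m)" if "length m = N" for m
    unfolding f_def using someI_ex [OF N [OF that]] .
  obtain ms :: "bool list list" where ms: "set ms = {m. length m = N}" "distinct ms"
    using finite_distinct_list [OF finite_words [of N]] by blast
  have len: "length (ms ! k) = N" if "k < length ms" for k
    using that ms(1) nth_mem by blast
  have ex: "\<exists>k<length ms. ms ! k = prefix_word N x" for x
  proof -
    have "prefix_word N x \<in> set ms" unfolding ms(1) by simp
    then show ?thesis by (simp add: in_set_conv_nth)
  qed
  have uniq: "k = k'" if "k < length ms" "k' < length ms" "ms ! k @@ y = ms ! k' @@ z" for k k' y z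
  proof -
    have "ms ! k = ms ! k'" using that len by (simp add: concat_word_eq_iff)
    then show ?thesis using that ms(2) by (simp add: nth_eq_iff_index_eq)
  qed
  have v: "v (ms ! k @@ x) = map f ms ! k @@ x" if "k < length ms" for k x
    using f [OF len [OF that]] that by (simp add: acts_by_def)
  have part: "is_cyl_partition ms"
    unfolding is_cyl_partition_def
  proof
    fix x
    obtain k where "k < length ms" "ms ! k = prefix_word N x" using ex by blast
    then have "k < length ms \<and> x \<in> cyl (ms ! k)"
      using in_cyl_prefix_word [of x N] by simp
    then show "\<exists>!k. k < length ms \<and> x \<in> cyl (ms ! k)"
      using uniq unfolding cyl_def mem_Collect_eq by metis
  qed
  \<comment> \<open>Bijectivity of \<open>v\<close> carries the partition of the source to one of
    the target.\<close>
  have part': "is_cyl_partition (map f ms)"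
    unfolding is_cyl_partition_def
  proof
    fix x
    obtain y where y: "x = v y" using bij by (metis bij_is_surj surjD)
    obtain k where k: "k < length ms" "ms ! k = prefix_word N y" using ex by blast
    then obtain z where z: "y = ms ! k @@ z" using in_cyl_prefix_word [of y N] by (auto simp: cyl_def)
    show "\<exists>!k. k < length (map f ms) \<and> x \<in> cyl (map f ms ! k)"
    proof
      show "k < length (map f ms) \<and> x \<in> cyl (map f ms ! k)"
        using k(1) v [OF k(1), of z] unfolding cyl_def y z by auto
    next
      fix k' assume "k' < length (map f ms) \<and> x \<in> cyl (map f ms ! k')"
      then obtain t where k': "k' < length ms" "v y = map f ms ! k' @@ t" by (auto simp: cyl_def y)
      with v [OF k'(1), of t] have "v y = v (ms ! k' @@ t)" by metis
      then have "y = ms ! k' @@ t" using bij by (simp add: bij_is_inj inj_eq)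
      then show "k' = k" using uniq k' k z by metis
    qed
  qed
  show "v \<in> thompsonV"
    unfolding thompsonV_def mem_Collect_eq using bij part part' v
    by (intro conjI exI [of _ ms] exI [of _ "map f ms"]) simp_all
qed

section \<open>\<open>V\<close> as a group, and the chain rule\<close>

lemma thompsonV_bij: "v \<in> thompsonV \<Longrightarrow> bij v"
  by (simp add: thompsonV_iff)

text \<open>Refining the cylinder appends the same letters to both words, so both can be made as
  long as desired. The bound \<open>L\<close> serves to control enough digits of the point or of its
  image.\<close>

lemma thompsonV_acts_byE:
  assumes "v \<in> thompsonV"
  obtains m m' y where "x = m @@ y" "acts_by v m m'" "L \<le> length m" "L \<le> length m'"
proof -
  obtain N where N: "\<And>m. length m = N \<Longrightarrow> \<exists>m'. acts_by v m m'"
    using assms by (auto simp: thompsonV_iff)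
  obtain m' where m': "acts_by v (prefix_word N x) m'" using N by force
  let ?r = "prefix_word L (\<lambda>i. x (N + i))"
  have "x = prefix_word N x @@ (?r @@ (\<lambda>i. x (N + (L + i))))"
    by (subst prefix_word_split [of "\<lambda>i. x (N + i)" L, symmetric]) (rule prefix_word_split)
  then have "x = (prefix_word N x @ ?r) @@ (\<lambda>i. x (N + (L + i)))"
    by (simp only: concat_word_append)
  from that [OF this acts_by_append [OF m']] show ?thesis by simp
qed

lemma thompsonV_id: "id \<in> thompsonV"
  by (auto simp: thompsonV_iff acts_by_def)

text \<open>Of the \<open>M + N\<close> letters, \<open>w\<close> reads the first \<open>M\<close>
  and leaves at least \<open>N\<close> letters for \<open>v\<close> to read.\<close>

lemma thompsonV_comp:
  assumes "v \<in> thompsonV" "w \<in> thompsonV"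
  shows "v \<circ> w \<in> thompsonV"
proof -
  obtain N where N: "\<And>m. length m = N \<Longrightarrow> \<exists>m'. acts_by v m m'"
    using assms by (auto simp: thompsonV_iff)
  obtain M where M: "\<And>m. length m = M \<Longrightarrow> \<exists>m'. acts_by w m m'"
    using assms by (auto simp: thompsonV_iff)
  have "\<exists>m'. acts_by (v \<circ> w) m m'" if m: "length m = M + N" for m
  proof -
    obtain m' where m': "acts_by w (take M m) m'" using M [of "take M m"] m by auto
    let ?q = "m' @ drop M m"
    have q: "acts_by w m ?q" using acts_by_append [OF m', of "drop M m"] by simp
    have "length (take N ?q) = N" using m by simp
    from N [OF this] obtain n' where "acts_by v (take N ?q) n'" ..
    from acts_by_append [OF this, of "drop N ?q"] have "acts_by v ?q (n' @ drop N ?q)"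
      by (metis append_take_drop_id)
    with q have "acts_by (v \<circ> w) m (n' @ drop N ?q)" by (simp add: acts_by_def)
    then show ?thesis ..
  qed
  then show ?thesis using assms unfolding thompsonV_iff by (blast intro: bij_comp)
qed

lemma thompsonV_vinv_apply [simp]: "v \<in> thompsonV \<Longrightarrow> vinv v (v x) = x"
  by (simp add: thompsonV_bij bij_is_inj)

lemma thompsonV_apply_vinv [simp]: "v \<in> thompsonV \<Longrightarrow> v (vinv v x) = x"
  by (simp add: thompsonV_bij bij_is_surj surj_f_inv_f)

lemma thompsonV_eq_iff [simp]: "v \<in> thompsonV \<Longrightarrow> v x = v y \<longleftrightarrow> x = y"
  by (metis thompsonV_vinv_apply)

lemma thompsonV_comp_vinv [simp]: "v \<in> thompsonV \<Longrightarrow> v \<circ> vinv v = id"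
  by (auto simp: fun_eq_iff)

lemma thompsonV_vinv_comp [simp]: "v \<in> thompsonV \<Longrightarrow> vinv v \<circ> v = id"
  by (auto simp: fun_eq_iff)

text \<open>A word at least as long as every image word \<open>f m\<close> extends one of them, so
  the rule there can be read backwards. The sum \<open>L\<close> of the finitely many lengths serves
  as the bound.\<close>

lemma thompsonV_vinv:
  assumes "v \<in> thompsonV"
  shows "vinv v \<in> thompsonV"
proof -
  obtain N where N: "\<And>m. length m = N \<Longrightarrow> \<exists>m'. acts_by v m m'"
    using assms unfolding thompsonV_iff by blast
  define f where "f m = (SOME m'. acts_by v m m')" for m
  have f: "acts_by v m (f m)" if "length m = N" for m
    unfolding f_def using someI_ex [OF N [OF that]] .
  define L where "L = (\<Sum>m\<in>{m. length m = N}. length (f m))"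
  have L: "length (f m) \<le> L" if "length m = N" for m
    unfolding L_def by (rule member_le_sum) (use finite_words that in auto)
  have "\<exists>m. acts_by (vinv v) q m" if q: "length q = L" for q
  proof -
    let ?z = "vinv v (q @@ (\<lambda>_. False))"
    let ?m = "prefix_word N ?z"
    have "q @@ (\<lambda>_. False) = v (?m @@ (\<lambda>i. ?z (N + i)))"
      using assms by (simp flip: prefix_word_split)
    also have "\<dots> = f ?m @@ (\<lambda>i. ?z (N + i))"
      using f [of ?m] by (simp add: acts_by_def)
    finally obtain r where r: "q = f ?m @ r"
      using L [of ?m] q by (metis concat_word_prefixE length_prefix_word)
    have "v ((?m @ r) @@ y) = q @@ y" for y
      using acts_by_append [OF f, of ?m r] r by (simp add: acts_by_def)
    then have "acts_by (vinv v) q (?m @ r)"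
      unfolding acts_by_def by (metis assms thompsonV_vinv_apply)
    then show ?thesis ..
  qed
  then show ?thesis
    using assms unfolding thompsonV_iff by (blast intro: bij_imp_bij_inv)
qed

lemma vinv_comp: "v \<in> thompsonV \<Longrightarrow> w \<in> thompsonV \<Longrightarrow> vinv (v \<circ> w) = vinv w \<circ> vinv v"
  by (simp add: o_inv_distrib thompsonV_bij)

lemma vinv_vinv: "v \<in> thompsonV \<Longrightarrow> vinv (vinv v) = v"
  by (simp add: inv_inv_eq thompsonV_bij)

lemma thompsonV_funpow: "v \<in> thompsonV \<Longrightarrow> v ^^ n \<in> thompsonV"
  by (induction n) (auto simp: thompsonV_id thompsonV_comp)

text \<open>The cylinder for \<open>w\<close> is taken so small that its image lies in a cylinder on
  which \<open>v\<close> replaces a prefix; the word lengths then telescope.\<close>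

lemma log_slope_comp:
  assumes "v \<in> thompsonV" "w \<in> thompsonV"
  shows "log_slope (v \<circ> w) x = log_slope v (w x) + log_slope w x"
proof -
  obtain n n' z where n: "w x = n @@ z" "acts_by v n n'"
    by (rule thompsonV_acts_byE [OF assms(1), of "w x" 0])
  obtain m m' y where m: "x = m @@ y" "acts_by w m m'" "length n \<le> length m'"
    by (rule thompsonV_acts_byE [OF assms(2), of x "length n"])
  have wx: "w x = m' @@ y" using m by (simp add: acts_by_def)
  with n m obtain r where r: "m' = n @ r" by (metis concat_word_prefixE)
  have v: "acts_by v m' (n' @ r)" using acts_by_append n r by simp
  then have "acts_by (v \<circ> w) m (n' @ r)" using m by (simp add: acts_by_def)
  from log_slope_eq [OF this, of y] log_slope_eq [OF v, of y] log_slope_eq [OF m(2), of y]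
  show ?thesis unfolding m(1) [symmetric] wx [symmetric] by simp
qed

lemma log_slope_id [simp]: "log_slope id x = 0"
  using log_slope_eq [of id "[]" "[]" x] by (simp add: acts_by_def)

lemma log_slope_vinv:
  assumes "v \<in> thompsonV"
  shows "log_slope (vinv v) (v x) = - log_slope v x"
  using log_slope_comp [OF thompsonV_vinv [OF assms] assms, of x] assms by simp

lemma concat_word_Q2_iff [simp]: "m @@ y \<in> Q2 \<longleftrightarrow> y \<in> Q2"
proof -
  have eq: "{n. (m @@ y) n} = {n. n < length m \<and> m ! n} \<union> (\<lambda>i. length m + i) ` {i. y i}"
    by (auto simp: concat_word_def image_def)
  have "finite ((\<lambda>i. length m + i) ` {i. y i}) \<longleftrightarrow> finite {i. y i}"
    by (rule finite_image_iff) (simp add: inj_on_def)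
  then show ?thesis unfolding Q2_def mem_Collect_eq eq by simp
qed

lemma thompsonV_Q2_iff:
  assumes "v \<in> thompsonV"
  shows "v x \<in> Q2 \<longleftrightarrow> x \<in> Q2"
proof -
  obtain m m' y where "x = m @@ y" "acts_by v m m'"
    by (rule thompsonV_acts_byE [OF assms, of x 0])
  then show ?thesis by (simp add: acts_by_def)
qed

lemma vinv_Q2_iff [simp]: "v \<in> thompsonV \<Longrightarrow> vinv v x \<in> Q2 \<longleftrightarrow> x \<in> Q2"
  using thompsonV_Q2_iff [OF thompsonV_vinv] .

section \<open>Dynamics on the dyadic rationals\<close>

lemma Q2_bound: "x \<in> Q2 \<Longrightarrow> \<exists>n. \<forall>i\<ge>n. \<not> x i"
  by (auto simp: Q2_def finite_nat_set_iff_bounded) (metis not_le)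

lemma Q2_uniform_bound:
  assumes "finite A" "A \<subseteq> Q2"
  shows "\<exists>N. \<forall>x\<in>A. \<forall>i\<ge>N. \<not> x i"
proof -
  obtain n where n: "\<forall>x\<in>A. \<forall>i\<ge>n x. \<not> x i"
    using bchoice [of A "\<lambda>x n. \<forall>i\<ge>n. \<not> x i"] Q2_bound assms(2) by blast
  have "n x \<le> (\<Sum>x\<in>A. n x)" if "x \<in> A" for x
    using assms(1) that by (simp add: member_le_sum)
  then show ?thesis using n by (meson order_trans)
qed

lemma infinite_Q2_nbhd: "infinite {y \<in> Q2. \<forall>i<N. y i = x i}"
proof -
  \<comment> \<open>The points \<open>t n\<close> share the first \<open>N\<close> digits of
    \<open>x\<close> and have a single further digit \<open>1\<close>, at place
    \<open>N + n\<close>.\<close>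
  define t where "t n = (\<lambda>i. if i < N then x i else i = N + n)" for n :: nat
  have "inj t"
  proof (rule injI)
    fix a b assume "t a = t b"
    from fun_cong [OF this, of "N + a"] show "a = b" by (simp add: t_def)
  qed
  moreover have "t n \<in> {y \<in> Q2. \<forall>i<N. y i = x i}" for n
  proof -
    have "{i. t n i} \<subseteq> {..N + n}" by (auto simp: t_def split: if_splits)
    then have "t n \<in> Q2" unfolding Q2_def by (simp add: finite_subset)
    then show ?thesis by (simp add: t_def)
  qed
  ultimately show ?thesis
    by (meson image_subsetI infinite_super range_inj_infinite)
qed

lemma infinite_Q2: "infinite Q2"
  using infinite_Q2_nbhd [of 0] by simp

text \<open>By continuity: the image word is longer than \<open>i\<close>, so the digit at which
  \<open>v x\<close> differs from \<open>x\<close> is determined by a prefix of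
  \<open>x\<close>.\<close>

lemma thompsonV_moves_nbhd:
  assumes "v \<in> thompsonV" "v x \<noteq> x"
  shows "\<exists>N. \<forall>y. (\<forall>i<N. y i = x i) \<longrightarrow> v y \<noteq> y"
proof -
  obtain i where i: "v x i \<noteq> x i" using assms(2) by blast
  obtain m m' z where m: "x = m @@ z" "acts_by v m m'" "Suc i \<le> length m" "Suc i \<le> length m'"
    by (rule thompsonV_acts_byE [OF assms(1), of x "Suc i"])
  have "v y \<noteq> y" if y: "\<forall>j<length m. y j = x j" for y
  proof -
    have "prefix_word (length m) y = m"
      using y by (auto simp: prefix_word_def m concat_word_def intro!: nth_equalityI)
    then obtain t where t: "y = m @@ t"
      using in_cyl_prefix_word [of y "length m"] by (auto simp: cyl_def)
    have "v y i = v x i"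
      using m by (simp add: t acts_by_def concat_word_def)
    moreover have "y i = x i" using y m by simp
    ultimately show ?thesis using i by metis
  qed
  then show ?thesis by blast
qed

text \<open>The set of moved points is open, and a nonempty open set contains infinitely many dyadic
  points.\<close>

lemma thompsonV_infinite_support:
  assumes "v \<in> thompsonV" "v \<noteq> id"
  shows "infinite {x \<in> Q2. v x \<noteq> x}"
proof -
  obtain x where "v x \<noteq> x" using assms(2) by (auto simp: fun_eq_iff)
  then obtain N where "\<forall>y. (\<forall>i<N. y i = x i) \<longrightarrow> v y \<noteq> y"
    using thompsonV_moves_nbhd assms(1) by blast
  then have "{y \<in> Q2. \<forall>i<N. y i = x i} \<subseteq> {x \<in> Q2. v x \<noteq> x}" by blast
  then show ?thesis using infinite_Q2_nbhd infinite_super by blast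
qed

lemma thompsonV_eq_id:
  assumes "v \<in> thompsonV" "\<And>x. x \<in> Q2 \<Longrightarrow> v x = x"
  shows "v = id"
proof (rule ccontr)
  assume "v \<noteq> id"
  moreover have "{x \<in> Q2. v x \<noteq> x} = {}" using assms(2) by blast
  ultimately show False using thompsonV_infinite_support [OF assms(1)] by (metis finite.emptyI)
qed

section \<open>Permutations of words of fixed length and high transitivity\<close>

text \<open>These maps permute the words of length \<open>N\<close> and keep the tail. The
  description by digits suits both the extensions of finite injections and the adding machines
  below.\<close>

definition level_perm :: "nat \<Rightarrow> (cantor \<Rightarrow> cantor) \<Rightarrow> bool" where
  "level_perm N v \<longleftrightarrow> bij v \<and> (\<forall>y n. N \<le> n \<longrightarrow> v y n = y n) \<and>
     (\<forall>y y'. (\<forall>n<N. y n = y' n) \<longrightarrow> (\<forall>n<N. v y n = v y' n))"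

lemma level_perm_acts_by:
  assumes "level_perm N v" "length m = N"
  shows "acts_by v m (prefix_word N (v (m @@ (\<lambda>_. False))))"
  unfolding acts_by_def
proof (intro allI ext)
  fix y i
  have "v (m @@ y) i = v (m @@ (\<lambda>_. False)) i" if "i < N"
  proof -
    have "\<forall>n<N. (m @@ y) n = (m @@ (\<lambda>_. False)) n" using assms(2) by (simp add: concat_word_less)
    then show ?thesis using assms(1) that unfolding level_perm_def by blast
  qed
  moreover have "v (m @@ y) i = (m @@ y) i" if "N \<le> i"
    using assms that unfolding level_perm_def by blast
  ultimately show "v (m @@ y) i = (prefix_word N (v (m @@ (\<lambda>_. False))) @@ y) i"
    using assms(2) by (auto simp: concat_word_def prefix_word_def)
qed

lemma level_perm_thompsonV:
  assumes "level_perm N v"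
  shows "v \<in> thompsonV"
proof -
  have "bij v" using assms unfolding level_perm_def by (rule conjunct1)
  then show ?thesis unfolding thompsonV_iff using level_perm_acts_by [OF assms] by blast
qed

lemma level_perm_log_slope:
  assumes "level_perm N v"
  shows "log_slope v x = 0"
proof -
  obtain y where "x = prefix_word N x @@ y"
    using in_cyl_prefix_word [of x N] by (auto simp: cyl_def)
  then show ?thesis
    using log_slope_eq [OF level_perm_acts_by [OF assms, of "prefix_word N x"], of y] by simp
qed

text \<open>Points that vanish from place \<open>N\<close> on correspond to words of length
  \<open>N\<close>. The injection \<open>f\<close> extends to a permutation of these words, because
  the complements of \<open>A\<close> and of its image have equal size, and this permutation acts on
  prefixes with slope one.\<close>

lemma thompsonV_highly_transitive:
  assumes "finite A" "A \<subseteq> Q2" "inj_on f A" "f ` A \<subseteq> Q2"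
  obtains v where "v \<in> thompsonV" "\<And>a. a \<in> A \<Longrightarrow> v a = f a" "\<And>x. log_slope v x = 0"
proof -
  obtain N where N: "\<forall>x\<in>A \<union> f ` A. \<forall>i\<ge>N. \<not> x i"
    using Q2_uniform_bound [of "A \<union> f ` A"] assms by auto
  define T :: "cantor set" where "T = {x. \<forall>i\<ge>N. \<not> x i}"
  have "T \<subseteq> (\<lambda>m. m @@ (\<lambda>_. False)) ` {m. length m = N}"
  proof
    fix x assume "x \<in> T"
    then have "x = prefix_word N x @@ (\<lambda>_. False)"
      by (auto simp: T_def concat_word_def prefix_word_def fun_eq_iff)
    then show "x \<in> (\<lambda>m. m @@ (\<lambda>_. False)) ` {m. length m = N}" by (rule image_eqI) simp
  qed
  then have finX: "finite T" using finite_words finite_subset by blast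
  have sub: "A \<subseteq> T" "f ` A \<subseteq> T" using N by (auto simp: T_def)
  have "card (T - A) = card (T - f ` A)"
    using assms finX sub by (simp add: card_Diff_subset card_image)
  then obtain h where h: "bij_betw h (T - A) (T - f ` A)"
    using finX by (metis finite_Diff finite_same_card_bij)
  define g where "g x = (if x \<in> A then f x else h x)" for x
  have "bij_betw g A (f ` A)" using assms(3) by (auto simp: bij_betw_def inj_on_def g_def)
  moreover have "bij_betw g (T - A) (T - f ` A)"
    using h bij_betw_cong [of "T - A" g h] by (simp add: g_def)
  ultimately have "bij_betw g (A \<union> (T - A)) (f ` A \<union> (T - f ` A))"
    by (rule bij_betw_combine) auto
  moreover have "A \<union> (T - A) = T" "f ` A \<union> (T - f ` A) = T" using sub by auto
  ultimately have g: "bij_betw g T T" by simp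
  \<comment> \<open>\<open>tr\<close> cuts a sequence down to a point of \<open>T\<close>;
    \<open>ext k\<close> lets \<open>k\<close> act on that point and puts the tail back.\<close>
  define tr :: "cantor \<Rightarrow> cantor" where "tr y = (\<lambda>i. i < N \<and> y i)" for y
  define ext :: "(cantor \<Rightarrow> cantor) \<Rightarrow> cantor \<Rightarrow> cantor"
    where "ext k y = (\<lambda>i. if i < N then k (tr y) i else y i)" for k y
  have trX: "tr y \<in> T" for y by (simp add: tr_def T_def)
  have tr_id: "tr y = y" if "y \<in> T" for y
    using that by (auto simp: tr_def T_def fun_eq_iff) (metis not_le_imp_less)
  have tr_ext: "tr (ext k y) = tr (k (tr y))" for k y by (auto simp: tr_def ext_def)
  have inv: "ext k' (ext k y) = y" if "\<And>x. x \<in> T \<Longrightarrow> k x \<in> T" "\<And>x. x \<in> T \<Longrightarrow> k' (k x) = x" for k k' y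
  proof
    fix i
    have "k' (tr (ext k y)) = tr y" using that trX tr_ext tr_id by simp
    then show "ext k' (ext k y) i = y i" by (simp add: ext_def tr_def)
  qed
  let ?g' = "inv_into T g"
  have "ext ?g' (ext g y) = y" "ext g (ext ?g' y) = y" for y
    using g by (auto intro!: inv simp: bij_betw_def inv_into_into f_inv_into_f)
  then have "bij (ext g)" by (intro o_bij [of "ext ?g'"]) auto
  moreover have "tr y = tr y'" if "\<forall>n<N. y n = y' n" for y y'
    using that by (auto simp: tr_def)
  ultimately have "level_perm N (ext g)" unfolding level_perm_def ext_def by simp metis
  moreover have "ext g a = f a" if "a \<in> A" for a
  proof
    fix i
    have "tr a = a" using tr_id sub that by blast
    moreover have "\<not> a i" "\<not> f a i" if "\<not> i < N"
      using that bspec [OF N, of a] bspec [OF N, of "f a"] \<open>a \<in> A\<close> by (simp_all add: not_less)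
    ultimately show "ext g a i = f a i"
      using that by (cases "i < N") (simp_all add: ext_def g_def)
  qed
  ultimately show ?thesis
    using that level_perm_thompsonV level_perm_log_slope by blast
qed

lemma thompsonV_highly_transitive_list:
  assumes "distinct xs" "distinct ys" "length xs = length ys" "set xs \<subseteq> Q2" "set ys \<subseteq> Q2"
  obtains v where "v \<in> thompsonV" "map v xs = ys" "\<And>x. log_slope v x = 0"
proof -
  let ?f = "\<lambda>x. the (map_of (zip xs ys) x)"
  have f: "?f (xs ! i) = ys ! i" if "i < length xs" for i
    using assms that by (simp add: map_of_zip_nth)
  have inj: "inj_on ?f (set xs)"
    using assms f by (auto simp: inj_on_def in_set_conv_nth nth_eq_iff_index_eq)
  have img: "?f ` set xs \<subseteq> Q2"
    using assms f by (auto simp: in_set_conv_nth) (metis nth_mem subsetD)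
  show ?thesis
  proof (rule thompsonV_highly_transitive [OF finite_set assms(4) inj img])
    fix v assume v: "v \<in> thompsonV" "\<And>a. a \<in> set xs \<Longrightarrow> v a = ?f a" "\<And>x. log_slope v x = 0"
    have "map v xs = ys" using v(2) assms f by (auto intro!: nth_equalityI)
    then show ?thesis using that v(1,3) by blast
  qed
qed

section \<open>Conjugates that do not commute with given elements\<close>

lemma exists_fresh_pair:
  assumes "u \<in> thompsonV" "infinite S" "finite B"
  shows "\<exists>d\<in>S. d \<notin> B \<and> u d \<notin> B"
proof (rule ccontr)
  assume "\<not> ?thesis"
  then have "S \<subseteq> B \<union> vinv u ` B"
    using assms(1) by (force simp: image_iff)
  then show False using assms by (meson finite_UnI finite_imageI finite_subset)
qed

lemma exists_fresh_Q2: "finite B \<Longrightarrow> \<exists>d\<in>Q2. d \<notin> B"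
  using infinite_Q2 by (meson finite_subset subsetI)

text \<open>With \<open>p1\<close> moved by \<open>u1\<close>, it is enough that the conjugate sends
  \<open>p1\<close> to \<open>q1\<close> and \<open>u1 p1\<close> to some \<open>s1\<close> other
  than \<open>u1 q1\<close>. High transitivity arranges this for \<open>u1\<close> and
  \<open>u2\<close> at once, since \<open>u\<close> moves infinitely many points and offers four
  disjoint pairs of a point and its image.\<close>

lemma thompsonV_conj_not_commuting:
  assumes u: "u \<in> thompsonV" "u \<noteq> id" and u1: "u1 \<in> thompsonV" "u1 \<noteq> id"
    and u2: "u2 \<in> thompsonV" "u2 \<noteq> id"
  obtains w where "w \<in> thompsonV"
    "(w \<circ> u \<circ> vinv w) \<circ> u1 \<noteq> u1 \<circ> (w \<circ> u \<circ> vinv w)"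
    "(w \<circ> u \<circ> vinv w) \<circ> u2 \<noteq> u2 \<circ> (w \<circ> u \<circ> vinv w)"
proof -
  let ?S = "\<lambda>u. {x \<in> Q2. u x \<noteq> x}"
  note inf = thompsonV_infinite_support
  obtain p1 where p1: "p1 \<in> ?S u1"
    using exists_fresh_pair [OF u1(1) inf [OF u1], of "{}"] by auto
  obtain p2 where p2: "p2 \<in> ?S u2" "p2 \<notin> {p1, u1 p1}" "u2 p2 \<notin> {p1, u1 p1}"
    using exists_fresh_pair [OF u2(1) inf [OF u2], of "{p1, u1 p1}"] by auto
  obtain q1 where q1: "q1 \<in> Q2" "q1 \<notin> {p1, u1 p1, p2, u2 p2}"
    using exists_fresh_Q2 [of "{p1, u1 p1, p2, u2 p2}"] by auto
  obtain q2 where q2: "q2 \<in> Q2" "q2 \<notin> {p1, u1 p1, p2, u2 p2, q1}"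
    using exists_fresh_Q2 [of "{p1, u1 p1, p2, u2 p2, q1}"] by auto
  obtain s1 where s1: "s1 \<in> Q2" "s1 \<notin> {p1, u1 p1, p2, u2 p2, q1, q2, u1 q1}"
    using exists_fresh_Q2 [of "{p1, u1 p1, p2, u2 p2, q1, q2, u1 q1}"] by auto
  obtain s2 where s2: "s2 \<in> Q2" "s2 \<notin> {p1, u1 p1, p2, u2 p2, q1, q2, s1, u2 q2}"
    using exists_fresh_Q2 [of "{p1, u1 p1, p2, u2 p2, q1, q2, s1, u2 q2}"] by auto
  obtain d1 where d1: "d1 \<in> ?S u"
    using exists_fresh_pair [OF u(1) inf [OF u], of "{}"] by auto
  obtain e1 where e1: "e1 \<in> ?S u" "e1 \<notin> {d1, u d1}" "u e1 \<notin> {d1, u d1}"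
    using exists_fresh_pair [OF u(1) inf [OF u], of "{d1, u d1}"] by auto
  obtain d2 where d2: "d2 \<in> ?S u" "d2 \<notin> {d1, u d1, e1, u e1}" "u d2 \<notin> {d1, u d1, e1, u e1}"
    using exists_fresh_pair [OF u(1) inf [OF u], of "{d1, u d1, e1, u e1}"] by auto
  obtain e2 where e2: "e2 \<in> ?S u" "e2 \<notin> {d1, u d1, e1, u e1, d2, u d2}"
    "u e2 \<notin> {d1, u d1, e1, u e1, d2, u d2}"
    using exists_fresh_pair [OF u(1) inf [OF u], of "{d1, u d1, e1, u e1, d2, u d2}"] by auto
  \<comment> \<open>The entries come in pairs: \<open>u\<close> takes the first of each pair of
    \<open>?xs\<close> to the second, so the conjugate by \<open>w\<close> does the same for
    \<open>?ys\<close>.\<close>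
  let ?xs = "[d1, u d1, e1, u e1, d2, u d2, e2, u e2]"
  let ?ys = "[p1, q1, u1 p1, s1, p2, q2, u2 p2, s2]"
  have dx: "distinct ?xs" using d1 e1 d2 e2 u(1) by auto
  have dy: "distinct ?ys" using p1 p2 q1 q2 s1 s2 by auto
  have len: "length ?xs = length ?ys" by simp
  have qx: "set ?xs \<subseteq> Q2" using d1 e1 d2 e2 thompsonV_Q2_iff [OF u(1)] by auto
  have qy: "set ?ys \<subseteq> Q2" using p1 p2 q1 q2 s1 s2 thompsonV_Q2_iff [OF u1(1)] thompsonV_Q2_iff [OF u2(1)] by auto
  obtain w where w: "w \<in> thompsonV" "map w ?xs = ?ys"
    by (rule thompsonV_highly_transitive_list [OF dx dy len qx qy])
  let ?u = "w \<circ> u \<circ> vinv w"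
  have conj: "?u (w x) = w (u x)" for x using w(1) by simp
  have "?u p1 = q1" "?u (u1 p1) = s1" "?u p2 = q2" "?u (u2 p2) = s2"
    using w(2) conj [of d1] conj [of e1] conj [of d2] conj [of e2] by simp_all
  then have "(?u \<circ> u1) p1 \<noteq> (u1 \<circ> ?u) p1" "(?u \<circ> u2) p2 \<noteq> (u2 \<circ> ?u) p2"
    using s1 s2 by simp_all
  then show ?thesis using that [OF w(1)] by metis
qed

text \<open>\<open>odometer j k\<close> is the binary adding machine on the bits \<open>j + k, \<dots>, j\<close> (least significant
  bit first), so that its \<open>2 ^ k\<close>-th power flips the bit \<open>j\<close>.\<close>

fun odometer :: "nat \<Rightarrow> nat \<Rightarrow> cantor \<Rightarrow> cantor" where
  "odometer j 0 y = y(j := \<not> y j)"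
| "odometer j (Suc k) y =
     (if y (j + Suc k) then (odometer j k y)(j + Suc k := False) else y(j + Suc k := True))"

lemma odometer_outside: "i < j \<or> j + k < i \<Longrightarrow> odometer j k y i = y i"
  by (induction k) auto

lemma odometer_upd: "j + k < i \<Longrightarrow> odometer j k (y(i := b)) = (odometer j k y)(i := b)"
  by (induction k) (auto simp: fun_eq_iff)

text \<open>The digit \<open>j + Suc k\<close> is the least significant one. Two increments restore
  it and carry exactly once into the remaining digits.\<close>

lemma odometer_Suc_Suc: "odometer j (Suc k) (odometer j (Suc k) y) = odometer j k y"
proof -
  have "(odometer j k y)(j + Suc k := y (j + Suc k)) = odometer j k y"
    using odometer_outside [of "j + Suc k" j k y] by (auto simp: fun_eq_iff)
  then show ?thesis by (auto simp: odometer_upd)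
qed

lemma odometer_local:
  assumes "\<forall>n<N. y n = y' n" "j + k < N" "n < N"
  shows "odometer j k y n = odometer j k y' n"
  using assms(2) by (induction k) (use assms in auto)

text \<open>Confined to the cylinder of the first \<open>j\<close> digits of \<open>c\<close>, the
  machine fixes everything outside. This provides roots that fix a given point and, for
  \<open>k = 0\<close>, an involution supported in a small cylinder.\<close>

definition cyl_odometer :: "nat \<Rightarrow> cantor \<Rightarrow> nat \<Rightarrow> cantor \<Rightarrow> cantor" where
  "cyl_odometer j c k y = (if \<forall>i<j. y i = c i then odometer j k y else y)"

lemma cyl_odometer_Suc_Suc: "cyl_odometer j c (Suc k) \<circ> cyl_odometer j c (Suc k) = cyl_odometer j c k"
proof
  fix y
  show "(cyl_odometer j c (Suc k) \<circ> cyl_odometer j c (Suc k)) y = cyl_odometer j c k y"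
  proof (cases "\<forall>i<j. y i = c i")
    case True
    then have "\<forall>i<j. odometer j (Suc k) y i = c i" using odometer_outside by metis
    with True have "cyl_odometer j c (Suc k) y = odometer j (Suc k) y"
      "cyl_odometer j c (Suc k) (odometer j (Suc k) y) = odometer j k y"
      "cyl_odometer j c k y = odometer j k y"
      unfolding cyl_odometer_def odometer_Suc_Suc by (simp_all only: if_P)
    then show ?thesis by (simp only: comp_apply)
  next
    case False
    then show ?thesis unfolding cyl_odometer_def comp_apply by (simp only: if_not_P if_False)
  qed
qed

lemma cyl_odometer_0_0: "cyl_odometer j c 0 \<circ> cyl_odometer j c 0 = id"
  by (auto simp: cyl_odometer_def fun_eq_iff)

lemma cyl_odometer_funpow: "cyl_odometer j c k ^^ (2 ^ k) = cyl_odometer j c 0"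
proof (induction k)
  case (Suc k)
  have "cyl_odometer j c (Suc k) ^^ (2 ^ Suc k) = (cyl_odometer j c (Suc k) ^^ 2) ^^ (2 ^ k)"
    by (simp only: funpow_mult power_Suc mult.commute)
  also have "cyl_odometer j c (Suc k) ^^ 2 = cyl_odometer j c k"
    using cyl_odometer_Suc_Suc by (simp add: numeral_2_eq_2 fun_eq_iff)
  finally show ?case using Suc by simp
qed auto

text \<open>The machine of level \<open>0\<close> is an involution, and a map whose square is
  bijective is itself bijective.\<close>

lemma cyl_odometer_bij: "bij (cyl_odometer j c k)"
proof (induction k)
  case 0
  then show ?case using cyl_odometer_0_0 o_bij by blast
next
  case (Suc k)
  then have "bij (cyl_odometer j c (Suc k) \<circ> cyl_odometer j c (Suc k))"
    by (simp only: cyl_odometer_Suc_Suc)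
  note ff = this
  have "inj (cyl_odometer j c (Suc k))"
    using bij_is_inj [OF ff] by (rule inj_on_imageI2)
  moreover have "surj (cyl_odometer j c (Suc k))"
  proof (rule surjI)
    fix y
    show "cyl_odometer j c (Suc k) (cyl_odometer j c (Suc k)
        (vinv (cyl_odometer j c (Suc k) \<circ> cyl_odometer j c (Suc k)) y)) = y"
      using surj_f_inv_f [OF bij_is_surj [OF ff], of y] by (simp only: comp_apply)
  qed
  ultimately show ?case by (rule bijI)
qed

lemma cyl_odometer_level_perm: "level_perm (Suc (j + k)) (cyl_odometer j c k)"
  unfolding level_perm_def
proof (intro conjI cyl_odometer_bij allI impI)
  fix y :: cantor and n assume "Suc (j + k) \<le> n"
  then show "cyl_odometer j c k y n = y n"
    using odometer_outside by (auto simp: cyl_odometer_def)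
next
  fix y y' :: cantor and n assume "\<forall>n<Suc (j + k). y n = y' n" "n < Suc (j + k)"
  then show "cyl_odometer j c k y n = cyl_odometer j c k y' n"
    using odometer_local [of "Suc (j + k)" y y' j k n] by (auto simp: cyl_odometer_def)
qed

text \<open>Write \<open>n = 2 ^ k * q\<close> with \<open>q\<close> odd. The power
  \<open>2 ^ k\<close> of the machine of level \<open>k\<close> is the involution of level
  \<open>0\<close>, which equals its own odd powers.\<close>

lemma cyl_odometer_root:
  assumes "1 \<le> n"
  shows "\<exists>k. cyl_odometer j c k ^^ n = cyl_odometer j c 0"
proof -
  obtain q where n: "n = 2 ^ multiplicity 2 n * q" "odd q"
    by (rule multiplicity_decompose' [of n 2]) (use assms in auto)
  define k where "k = multiplicity 2 n"
  note n = n [folded k_def]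
  then obtain r where q: "q = Suc (2 * r)" by (metis oddE Suc_eq_plus1)
  have "(cyl_odometer j c 0 ^^ 2) ^^ r = id"
    using cyl_odometer_0_0 [of j c] by (simp add: numeral_2_eq_2)
  then have "cyl_odometer j c 0 ^^ q = cyl_odometer j c 0"
    by (simp add: q funpow_mult)
  moreover have "cyl_odometer j c k ^^ n = (cyl_odometer j c k ^^ (2 ^ k)) ^^ q"
    by (simp add: n funpow_mult mult.commute)
  ultimately show ?thesis by (metis cyl_odometer_funpow)
qed

text \<open>If \<open>tangent_stab x\<close> acts on a finite set, then \<open>divisible_stab x\<close> acts on it trivially.\<close>

definition tangent_stab :: "cantor \<Rightarrow> (cantor \<Rightarrow> cantor) set" where
  "tangent_stab x = {v \<in> thompsonV. v x = x \<and> log_slope v x = 0}"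

definition divisible_stab :: "cantor \<Rightarrow> (cantor \<Rightarrow> cantor) set" where
  "divisible_stab x = {d \<in> tangent_stab x. \<forall>n\<ge>1. \<exists>e\<in>tangent_stab x. e ^^ n = d}"

lemma tangent_stab_conj:
  assumes "w \<in> tangent_stab x" "v \<in> thompsonV"
  shows "v \<circ> w \<circ> vinv v \<in> tangent_stab (v x)"
proof -
  have w: "w \<in> thompsonV" "w x = x" "log_slope w x = 0" using assms(1) by (auto simp: tangent_stab_def)
  have "log_slope (v \<circ> w \<circ> vinv v) (v x) = 0"
    using w assms(2)
    by (simp add: log_slope_comp log_slope_vinv thompsonV_comp thompsonV_vinv)
  then show ?thesis using w assms(2) by (simp add: tangent_stab_def thompsonV_comp thompsonV_vinv)
qed

lemma funpow_conj:
  assumes "v \<in> thompsonV"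
  shows "(v \<circ> e \<circ> vinv v) ^^ n = v \<circ> e ^^ n \<circ> vinv v"
proof (induction n)
  case (Suc n)
  show ?case
  proof
    fix x
    have "((v \<circ> e \<circ> vinv v) ^^ n) x = v ((e ^^ n) (vinv v x))"
      by (subst Suc) simp
    then show "((v \<circ> e \<circ> vinv v) ^^ Suc n) x = (v \<circ> e ^^ Suc n \<circ> vinv v) x"
      using assms by simp
  qed
qed (use assms in simp)

lemma divisible_stab_conj:
  assumes "d \<in> divisible_stab x" "v \<in> thompsonV"
  shows "v \<circ> d \<circ> vinv v \<in> divisible_stab (v x)"
proof -
  have "\<exists>e'\<in>tangent_stab (v x). e' ^^ n = v \<circ> d \<circ> vinv v" if "1 \<le> n" for n
  proof -
    have "\<forall>n\<ge>1. \<exists>e\<in>tangent_stab x. e ^^ n = d"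
      using assms(1) unfolding divisible_stab_def mem_Collect_eq by (rule conjunct2)
    from this [rule_format, OF that] obtain e where "e \<in> tangent_stab x" "e ^^ n = d" ..
    then show ?thesis using tangent_stab_conj assms(2) funpow_conj by metis
  qed
  moreover have "d \<in> tangent_stab x" using assms(1) by (simp add: divisible_stab_def)
  ultimately show ?thesis
    using tangent_stab_conj [OF _ assms(2)] by (simp add: divisible_stab_def)
qed

text \<open>Machines placed in the cylinder of the sequences whose first digit differs from that of
  \<open>x\<close> fix \<open>x\<close> with slope one.\<close>

lemma divisible_stab_nontrivial: "\<exists>d\<in>divisible_stab x. d \<noteq> id"
proof -
  let ?c = "x(0 := \<not> x 0)"
  have W: "cyl_odometer 1 ?c k \<in> tangent_stab x" for k
    using level_perm_thompsonV [OF cyl_odometer_level_perm] level_perm_log_slope [OF cyl_odometer_level_perm]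
    by (auto simp: tangent_stab_def) (auto simp: cyl_odometer_def)
  then have "cyl_odometer 1 ?c 0 \<in> divisible_stab x"
    unfolding divisible_stab_def using cyl_odometer_root by blast
  moreover have "cyl_odometer 1 ?c 0 ?c 1 \<noteq> id ?c 1" by (simp add: cyl_odometer_def)
  ultimately show ?thesis by metis
qed

lemma tangent_stab_transitive:
  assumes "x \<in> Q2" "y \<in> Q2" "y \<noteq> x" "y' \<in> Q2" "y' \<noteq> x"
  shows "\<exists>w\<in>tangent_stab x. w y = y'"
proof (rule thompsonV_highly_transitive_list [of "[x, y]" "[x, y']"])
  fix v assume "v \<in> thompsonV" "map v [x, y] = [x, y']" "\<And>x. log_slope v x = 0"
  then show ?thesis by (auto simp: tangent_stab_def)
qed (use assms in auto)

text \<open>A nontrivial \<open>d\<close> moves some dyadic \<open>u\<close>, and neither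
  \<open>u\<close> nor \<open>d u\<close> is \<open>x\<close>. An element taking
  \<open>x, u, d u\<close> to \<open>x, y, y'\<close> conjugates \<open>d\<close> to the element
  sought.\<close>

lemma divisible_stab_transitive:
  assumes "x \<in> Q2" "y \<in> Q2" "y \<noteq> x" "y' \<in> Q2" "y' \<noteq> x" "y \<noteq> y'"
  shows "\<exists>d\<in>divisible_stab x. d y = y'"
proof -
  obtain d where d: "d \<in> divisible_stab x" "d \<noteq> id" using divisible_stab_nontrivial by blast
  then have dV: "d \<in> thompsonV" and dx: "d x = x" by (auto simp: divisible_stab_def tangent_stab_def)
  obtain u where u: "u \<in> Q2" "d u \<noteq> u" using thompsonV_eq_id [OF dV] d(2) by blast
  have ne: "u \<noteq> x" "d u \<noteq> x" using u dx dV thompsonV_eq_iff by metis+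
  show ?thesis
  proof (rule thompsonV_highly_transitive_list [of "[x, u, d u]" "[x, y, y']"])
    fix v assume v: "v \<in> thompsonV" "map v [x, u, d u] = [x, y, y']"
    have "v \<circ> d \<circ> vinv v \<in> divisible_stab x" using divisible_stab_conj [OF d(1) v(1)] v(2) by simp
    moreover have "(v \<circ> d \<circ> vinv v) (v u) = v (d u)" using v(1) by simp
    moreover have "v u = y" "v (d u) = y'" using v(2) by simp_all
    ultimately show ?thesis by metis
  qed (use assms u ne thompsonV_Q2_iff [OF dV] in auto)
qed

text \<open>By equivariance the stabiliser of \<open>x\<close> fixes \<open>p x\<close>, yet it
  moves every dyadic point other than \<open>x\<close>. This will show that two point maps are
  mutually inverse.\<close>

lemma thompsonV_equivariant_id:
  assumes p: "\<And>v x. v \<in> thompsonV \<Longrightarrow> x \<in> Q2 \<Longrightarrow> p (v x) = v (p x)"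
    and "x \<in> Q2" "p x \<in> Q2"
  shows "p x = x"
proof (rule ccontr)
  assume ne: "p x \<noteq> x"
  obtain y where y: "y \<in> Q2" "y \<notin> {x, p x}" using exists_fresh_Q2 [of "{x, p x}"] by auto
  obtain w where "w \<in> tangent_stab x" "w (p x) = y"
    using tangent_stab_transitive [of x "p x" y] assms(2,3) ne y by auto
  with p [of w x] assms(2) y show False by (auto simp: tangent_stab_def)
qed

section \<open>Finite orbits and expanding fixed points\<close>

text \<open>Among \<open>card S + 1\<close> iterates two coincide, and injectivity turns this into a
  period of at most \<open>card S\<close>, which divides the factorial.\<close>

lemma funpow_fact_card:
  assumes "finite S" "inj f" "f ` S \<subseteq> S" "z \<in> S"
  shows "(f ^^ fact (card S)) z = z"
proof -
  have S: "(f ^^ n) z \<in> S" for n by (induction n) (use assms in auto)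
  have "\<not> inj_on (\<lambda>n. (f ^^ n) z) {..card S}"
  proof
    assume "inj_on (\<lambda>n. (f ^^ n) z) {..card S}"
    then have "card {..card S} \<le> card S" using S assms(1) by (metis card_inj_on_le image_subsetI)
    then show False by simp
  qed
  then obtain i j where ij: "i < j" "j \<le> card S" "(f ^^ i) z = (f ^^ j) z"
    unfolding inj_on_def by (metis atMost_iff linorder_neqE_nat)
  have "(f ^^ i) z = (f ^^ i) ((f ^^ (j - i)) z)"
    using ij by (simp flip: comp_apply [of "f ^^ i"] funpow_add)
  then have c: "(f ^^ (j - i)) z = z" using inj_fn [OF assms(2), of i] by (metis injD)
  have "j - i dvd fact (card S)" using ij by (intro dvd_fact) auto
  then obtain r where r: "fact (card S) = (j - i) * r" by blast
  have "((f ^^ (j - i)) ^^ r) z = z" by (induction r) (use c in auto)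
  then show ?thesis by (simp add: r funpow_mult)
qed

text \<open>While the orbit stays in the cylinder of \<open>n\<close>, the map removes more letters
  than it writes. A digit \<open>j\<close> of \<open>z\<close> beyond the prefix thus reappears at
  an earlier place of \<open>e z\<close>, where induction on \<open>j\<close> compares it with the
  fixed point.\<close>

lemma expanding_fixpoint_unique:
  assumes e: "acts_by e n n'" "length n' < length n" and y: "e (n @@ t) = n @@ t"
    and z: "\<And>k. \<exists>s. (e ^^ k) z = n @@ s"
  shows "z = n @@ t"
proof
  fix j
  show "z j = (n @@ t) j" using z
  proof (induction j arbitrary: z rule: less_induct)
    case (less j)
    obtain s where s: "z = n @@ s" using less.prems [of 0] by auto
    show ?case
    proof (cases "j < length n")
      case True
      then show ?thesis by (simp add: s concat_word_less)
    next
      case False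
      define j' where "j' = length n' + (j - length n)"
      have at: "(n @@ r) j = e (n @@ r) j'" for r
        using False e(1) concat_word_add [of n r "j - length n"] concat_word_add [of n' r "j - length n"]
        by (simp add: acts_by_def j'_def)
      have "\<exists>s. (e ^^ k) (e z) = n @@ s" for k
        using less.prems [of "Suc k"] by (simp add: funpow_swap1)
      then have "e z j' = (n @@ t) j'"
        by (rule less.IH [rotated]) (use False e(2) in \<open>simp add: j'_def\<close>)
      then show ?thesis using at [of s] at [of t] y s by simp
    qed
  qed
qed

section \<open>The twisted semidirect product\<close>

text \<open>An equivalence between consecutive integers gives induction in both directions. For
  identities between powers of a bijection, injectivity supplies the converse of the step.\<close>

lemma int_shift_induct:
  assumes "P 0" "\<And>k :: int. P k \<longleftrightarrow> P (k + 1)"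
  shows "P k"
proof (induction k rule: int_induct [of _ 0])
  case (step2 i)
  then show ?case using assms(2) [of "i - 1"] by simp
qed (use assms in auto)

lemma aut_pow_0 [simp]: "aut_pow G t 0 g = g"
  by (simp add: aut_pow_def)

lemma aut_pow_1 [simp]: "aut_pow G t 1 g = t g"
  by (simp add: aut_pow_def)

lemma aut_pow_closed:
  assumes "bij_betw t (carrier G) (carrier G)" "g \<in> carrier G"
  shows "aut_pow G t k g \<in> carrier G"
proof -
  have "(t ^^ n) g \<in> carrier G" for n
    by (induction n) (use assms bij_betwE in auto)
  moreover have "(inv_into (carrier G) t ^^ n) g \<in> carrier G" for n
    by (induction n) (use assms bij_betwE [OF bij_betw_inv_into [OF assms(1)]] in auto)
  ultimately show ?thesis by (simp add: aut_pow_def)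
qed

text \<open>For negative \<open>k\<close> one application of the inverse cancels against
  \<open>t\<close>. With this rule and \<open>int_shift_induct\<close> later arguments need no
  distinction of signs.\<close>

lemma aut_pow_Suc:
  assumes "bij_betw t (carrier G) (carrier G)" "g \<in> carrier G"
  shows "aut_pow G t (k + 1) g = t (aut_pow G t k g)"
proof (cases "0 \<le> k")
  case True
  then have "nat (k + 1) = Suc (nat k)" by simp
  then show ?thesis using True by (simp add: aut_pow_def)
next
  case False
  define n where "n = nat (- (k + 1))"
  have k: "k = - int (Suc n)" using False by (simp add: n_def)
  let ?i = "inv_into (carrier G) t"
  \<comment> \<open>At \<open>k + 1 = 0\<close> the definition of the power changes branch.\<close>
  have "(?i ^^ n) g = aut_pow G t (k + 1) g"
    using False by (cases "k + 1 = 0") (simp_all add: aut_pow_def n_def)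
  moreover have "aut_pow G t k g = ?i ((?i ^^ n) g)"
  proof -
    have "nat (- k) = Suc n" using k by simp
    then show ?thesis using False by (simp add: aut_pow_def)
  qed
  ultimately show ?thesis
    using aut_pow_closed [OF assms, of "k + 1"] bij_betw_inv_into_right [OF assms(1)] by simp
qed

lemma aut_pow_add:
  assumes t: "bij_betw t (carrier G) (carrier G)" and g: "g \<in> carrier G"
  shows "aut_pow G t (k + l) g = aut_pow G t k (aut_pow G t l g)"
proof (induction k rule: int_shift_induct)
  fix k :: int
  have "aut_pow G t (k + 1 + l) g = t (aut_pow G t (k + l) g)"
    using aut_pow_Suc [OF t g, of "k + l"] by (simp add: algebra_simps)
  moreover have "aut_pow G t (k + 1) (aut_pow G t l g) = t (aut_pow G t k (aut_pow G t l g))"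
    using aut_pow_Suc [OF t] aut_pow_closed [OF t] g by simp
  moreover have "inj_on t (carrier G)" using t by (simp add: bij_betw_def)
  ultimately show "aut_pow G t (k + l) g = aut_pow G t k (aut_pow G t l g) \<longleftrightarrow>
      aut_pow G t (k + 1 + l) g = aut_pow G t (k + 1) (aut_pow G t l g)"
    using aut_pow_closed [OF t] g by (simp add: inj_on_eq_iff)
qed simp

section \<open>The semidirect product and its summands\<close>

locale twisted_group = group \<Gamma> for \<Gamma> :: "('a, 'm) monoid_scheme" (structure) +
  fixes \<alpha> :: "'a \<Rightarrow> 'a"
  assumes aut: "\<alpha> \<in> iso \<Gamma> \<Gamma>"
begin

abbreviation QV where "QV \<equiv> semidirect_QV \<Gamma> \<alpha>"
abbreviation ap where "ap \<equiv> aut_pow \<Gamma> \<alpha>"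
abbreviation act where "act \<equiv> V_act \<Gamma> \<alpha>"

lemma aut_bij: "bij_betw \<alpha> (carrier \<Gamma>) (carrier \<Gamma>)"
  using aut by (simp add: iso_def)

lemma aut_mult: "g \<in> carrier \<Gamma> \<Longrightarrow> h \<in> carrier \<Gamma> \<Longrightarrow> \<alpha> (g \<otimes> h) = \<alpha> g \<otimes> \<alpha> h"
  using aut by (simp add: iso_def hom_mult)

lemma ap_closed [simp]: "g \<in> carrier \<Gamma> \<Longrightarrow> ap k g \<in> carrier \<Gamma>"
  using aut_pow_closed aut_bij by metis

lemma ap_add: "g \<in> carrier \<Gamma> \<Longrightarrow> ap (k + l) g = ap k (ap l g)"
  using aut_pow_add aut_bij by metis

lemma ap_mult:
  assumes "g \<in> carrier \<Gamma>" "h \<in> carrier \<Gamma>"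
  shows "ap k (g \<otimes> h) = ap k g \<otimes> ap k h"
proof (rule int_shift_induct)
  fix k :: int
  have "inj_on \<alpha> (carrier \<Gamma>)" using aut_bij by (simp add: bij_betw_def)
  then show "ap k (g \<otimes> h) = ap k g \<otimes> ap k h \<longleftrightarrow> ap (k + 1) (g \<otimes> h) = ap (k + 1) g \<otimes> ap (k + 1) h"
    using assms by (simp add: aut_pow_Suc [OF aut_bij] inj_on_eq_iff flip: aut_mult)
qed simp

lemma ap_one [simp]: "ap k \<one> = \<one>"
  using ap_mult [of \<one> \<one> k] by (simp add: l_cancel_one)

lemma ap_eq_one_iff: "g \<in> carrier \<Gamma> \<Longrightarrow> ap k g = \<one> \<longleftrightarrow> g = \<one>"
  using ap_add [of g "- k" k] by (metis ap_one add.left_inverse aut_pow_0)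

lemma fin_supp_outside: "a \<in> fin_supp \<Gamma> \<Longrightarrow> x \<notin> Q2 \<Longrightarrow> a x = \<one>"
  by (simp add: fin_supp_def)

lemma fin_supp_finite: "a \<in> fin_supp \<Gamma> \<Longrightarrow> finite {x. a x \<noteq> \<one>}"
  by (simp add: fin_supp_def)

lemma fin_suppI:
  assumes "\<And>x. a x \<in> carrier \<Gamma>" "\<And>x. x \<notin> Q2 \<Longrightarrow> a x = \<one>" "finite {x. a x \<noteq> \<one>}"
  shows "a \<in> fin_supp \<Gamma>"
  using assms by (simp add: fin_supp_def)

lemma fin_supp_closed [simp]: "a \<in> fin_supp \<Gamma> \<Longrightarrow> a x \<in> carrier \<Gamma>"
  by (cases "x \<in> Q2") (simp_all add: fin_supp_def)

lemma fin_supp_one [simp]: "(\<lambda>_. \<one>) \<in> fin_supp \<Gamma>"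
  by (rule fin_suppI) auto

lemma fin_supp_mult:
  assumes "a \<in> fin_supp \<Gamma>" "b \<in> fin_supp \<Gamma>"
  shows "(\<lambda>x. a x \<otimes> b x) \<in> fin_supp \<Gamma>"
proof (rule fin_suppI)
  have "{x. a x \<otimes> b x \<noteq> \<one>} \<subseteq> {x. a x \<noteq> \<one>} \<union> {x. b x \<noteq> \<one>}" by auto
  then show "finite {x. a x \<otimes> b x \<noteq> \<one>}"
    by (rule finite_subset) (use assms fin_supp_finite in auto)
qed (use assms fin_supp_outside [OF assms(1)] fin_supp_outside [OF assms(2)] in auto)

lemma fin_supp_inv:
  assumes "a \<in> fin_supp \<Gamma>"
  shows "(\<lambda>x. inv a x) \<in> fin_supp \<Gamma>"
proof (rule fin_suppI)
  have "{x. inv a x \<noteq> \<one>} \<subseteq> {x. a x \<noteq> \<one>}" by auto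
  then show "finite {x. inv a x \<noteq> \<one>}"
    by (rule finite_subset) (use assms fin_supp_finite in auto)
qed (use assms fin_supp_outside [OF assms] in auto)

lemma act_apply: "v \<in> thompsonV \<Longrightarrow> act v a (v x) = ap (log_slope v x) (a x)"
  by (simp add: V_act_def)

lemma act_fin_supp:
  assumes "v \<in> thompsonV" "a \<in> fin_supp \<Gamma>"
  shows "act v a \<in> fin_supp \<Gamma>"
proof (rule fin_suppI)
  have "{x. act v a x \<noteq> \<one>} \<subseteq> v ` {x. a x \<noteq> \<one>}"
  proof
    fix x assume "x \<in> {x. act v a x \<noteq> \<one>}"
    then have "a (vinv v x) \<noteq> \<one>" by (auto simp: V_act_def)
    then show "x \<in> v ` {x. a x \<noteq> \<one>}" using assms(1) by (intro image_eqI [of _ _ "vinv v x"]) simp_all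
  qed
  then show "finite {x. act v a x \<noteq> \<one>}"
    by (rule finite_subset) (use assms fin_supp_finite in auto)
qed (use assms fin_supp_outside [OF assms(2)] in \<open>auto simp: V_act_def\<close>)

lemma act_id [simp]: "act id a = a"
  by (rule ext) (simp add: V_act_def)

lemma act_one [simp]: "act v (\<lambda>_. \<one>) = (\<lambda>_. \<one>)"
  by (rule ext) (simp add: V_act_def)

lemma act_mult:
  assumes "a \<in> fin_supp \<Gamma>" "b \<in> fin_supp \<Gamma>"
  shows "act v (\<lambda>x. a x \<otimes> b x) = (\<lambda>x. act v a x \<otimes> act v b x)"
  using assms by (auto simp: V_act_def ap_mult)

lemma act_comp:
  assumes "v \<in> thompsonV" "w \<in> thompsonV" "a \<in> fin_supp \<Gamma>"
  shows "act (v \<circ> w) a = act v (act w a)"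
proof
  fix x
  define z where "z = vinv w (vinv v x)"
  have x: "x = v (w z)" using assms by (simp add: z_def)
  have "act (v \<circ> w) a x = ap (log_slope v (w z) + log_slope w z) (a z)"
    using act_apply [OF thompsonV_comp [OF assms(1,2)], of a z] assms log_slope_comp by (simp add: x)
  then show "act (v \<circ> w) a x = act v (act w a) x"
    using assms by (simp add: x act_apply ap_add)
qed

lemma QV_carrier: "carrier QV = fin_supp \<Gamma> \<times> thompsonV"
  by (simp add: semidirect_QV_def)

lemma QV_mult: "(a, v) \<otimes>\<^bsub>QV\<^esub> (b, w) = (\<lambda>x. a x \<otimes> act v b x, v \<circ> w)"
  by (simp add: semidirect_QV_def)

lemma QV_one: "\<one>\<^bsub>QV\<^esub> = (\<lambda>_. \<one>, id)"
  by (simp add: semidirect_QV_def)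

lemma QV_group: "group QV"
proof (rule groupI)
  fix p q assume "p \<in> carrier QV" "q \<in> carrier QV"
  then show "p \<otimes>\<^bsub>QV\<^esub> q \<in> carrier QV"
    by (auto simp: QV_carrier QV_mult act_fin_supp fin_supp_mult thompsonV_comp)
next
  show "\<one>\<^bsub>QV\<^esub> \<in> carrier QV" by (simp add: QV_carrier QV_one thompsonV_id)
next
  fix p q r assume "p \<in> carrier QV" "q \<in> carrier QV" "r \<in> carrier QV"
  then show "p \<otimes>\<^bsub>QV\<^esub> q \<otimes>\<^bsub>QV\<^esub> r = p \<otimes>\<^bsub>QV\<^esub> (q \<otimes>\<^bsub>QV\<^esub> r)"
    by (auto simp: QV_carrier QV_mult act_fin_supp fin_supp_mult thompsonV_comp act_comp act_mult
        m_assoc comp_assoc)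
next
  fix p assume "p \<in> carrier QV"
  then show "\<one>\<^bsub>QV\<^esub> \<otimes>\<^bsub>QV\<^esub> p = p" by (auto simp: QV_carrier QV_mult QV_one)
next
  fix p assume "p \<in> carrier QV"
  then obtain a v where p: "p = (a, v)" "a \<in> fin_supp \<Gamma>" "v \<in> thompsonV" by (auto simp: QV_carrier)
  have "(act (vinv v) (\<lambda>x. inv a x), vinv v) \<otimes>\<^bsub>QV\<^esub> p = \<one>\<^bsub>QV\<^esub>"
    using p by (simp add: QV_mult QV_one l_inv fin_supp_inv flip: act_mult)
  moreover have "(act (vinv v) (\<lambda>x. inv a x), vinv v) \<in> carrier QV"
    using p by (simp add: QV_carrier act_fin_supp fin_supp_inv thompsonV_vinv)
  ultimately show "\<exists>q\<in>carrier QV. q \<otimes>\<^bsub>QV\<^esub> p = \<one>\<^bsub>QV\<^esub>" by blast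
qed

definition single :: "cantor \<Rightarrow> 'a \<Rightarrow> cantor \<Rightarrow> 'a" where
  "single x g = (\<lambda>y. if y = x then g else \<one>)"

lemma single_fin_supp [simp]:
  assumes "x \<in> Q2" "g \<in> carrier \<Gamma>"
  shows "single x g \<in> fin_supp \<Gamma>"
proof (rule fin_suppI)
  show "finite {y. single x g y \<noteq> \<one>}" by (rule finite_subset [of _ "{x}"]) (auto simp: single_def)
qed (use assms in \<open>auto simp: single_def\<close>)

lemma single_QV [simp]: "x \<in> Q2 \<Longrightarrow> g \<in> carrier \<Gamma> \<Longrightarrow> (single x g, id) \<in> carrier QV"
  by (simp add: QV_carrier thompsonV_id)

lemma single_mult: 
  assumes "g \<in> carrier \<Gamma>" "h \<in> carrier \<Gamma>"
  shows "(single x g, id) \<otimes>\<^bsub>QV\<^esub> (single x h, id) = (single x (g \<otimes> h), id)"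
  using assms by (auto simp: QV_mult single_def)

lemma single_commute: 
  assumes "g \<in> carrier \<Gamma>" "h \<in> carrier \<Gamma>" "x \<noteq> y"
  shows "(single x g, id) \<otimes>\<^bsub>QV\<^esub> (single y h, id) = (single y h, id) \<otimes>\<^bsub>QV\<^esub> (single x g, id)"
  using assms by (auto simp: QV_mult single_def)

lemma act_single:
  assumes "v \<in> thompsonV"
  shows "act v (single x g) = single (v x) (ap (log_slope v x) g)"
proof
  fix y
  have "act v (single x g) (v (vinv v y)) = single (v x) (ap (log_slope v x) g) (v (vinv v y))"
    using assms by (simp add: act_apply single_def del: thompsonV_apply_vinv)
  then show "act v (single x g) y = single (v x) (ap (log_slope v x) g) y" using assms by simp
qed

text \<open>Conjugation takes the summand at \<open>x\<close> to that at \<open>v x\<close>, by a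
  power of \<alpha> followed by an inner automorphism. In this form, without inverses in the
  semidirect product, \<theta> can be applied at once.\<close>

lemma conj_single:
  assumes "a \<in> fin_supp \<Gamma>" "v \<in> thompsonV" "g \<in> carrier \<Gamma>"
  shows "(a, v) \<otimes>\<^bsub>QV\<^esub> (single x g, id) =
    (single (v x) (a (v x) \<otimes> ap (log_slope v x) g \<otimes> inv a (v x)), id) \<otimes>\<^bsub>QV\<^esub> (a, v)"
  unfolding QV_mult act_single [OF assms(2)]
  using assms by (auto simp: single_def m_assoc)

end

section \<open>The induced automorphism of V\<close>

locale QV_iso = dom: twisted_group \<Gamma> \<alpha> + cod: twisted_group \<Gamma>' \<alpha>'
  for \<Gamma> :: "('a, 'm) monoid_scheme" and \<alpha> and \<Gamma>' :: "('b, 'n) monoid_scheme" and \<alpha>' +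
  fixes \<theta>
  assumes iso: "\<theta> \<in> iso (semidirect_QV \<Gamma> \<alpha>) (semidirect_QV \<Gamma>' \<alpha>')"
begin

section \<open>The direct sum dies in the quotient\<close>

definition quot :: "(cantor \<Rightarrow> 'a) \<times> (cantor \<Rightarrow> cantor) \<Rightarrow> cantor \<Rightarrow> cantor" where
  "quot p = snd (\<theta> p)"

definition phi :: "(cantor \<Rightarrow> cantor) \<Rightarrow> cantor \<Rightarrow> cantor" where
  "phi v = quot (\<lambda>_. \<one>\<^bsub>\<Gamma>\<^esub>, v)"

lemma theta_closed: "p \<in> carrier dom.QV \<Longrightarrow> \<theta> p \<in> carrier cod.QV"
  using iso by (auto simp: iso_def hom_def)

lemma theta_mult:
  "p \<in> carrier dom.QV \<Longrightarrow> q \<in> carrier dom.QV \<Longrightarrow> \<theta> (p \<otimes>\<^bsub>dom.QV\<^esub> q) = \<theta> p \<otimes>\<^bsub>cod.QV\<^esub> \<theta> q"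
  using iso by (auto simp: iso_def hom_def)

lemma theta_bij: "bij_betw \<theta> (carrier dom.QV) (carrier cod.QV)"
  using iso by (simp add: iso_def)

lemma theta_one: "\<theta> (\<lambda>_. \<one>\<^bsub>\<Gamma>\<^esub>, id) = (\<lambda>_. \<one>\<^bsub>\<Gamma>'\<^esub>, id)"
  using hom_one [of \<theta> dom.QV cod.QV] iso dom.QV_group cod.QV_group
  by (simp add: iso_def dom.QV_one cod.QV_one)

lemma quot_thompsonV: "p \<in> carrier dom.QV \<Longrightarrow> quot p \<in> thompsonV"
  using theta_closed [of p] by (auto simp: quot_def cod.QV_carrier)

lemma quot_mult:
  assumes "p \<in> carrier dom.QV" "q \<in> carrier dom.QV"
  shows "quot (p \<otimes>\<^bsub>dom.QV\<^esub> q) = quot p \<circ> quot q"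
  unfolding quot_def theta_mult [OF assms]
  by (cases "\<theta> p"; cases "\<theta> q") (simp add: cod.QV_mult)

lemma quot_surj:
  assumes "v \<in> thompsonV"
  obtains p where "p \<in> carrier dom.QV" "quot p = v"
proof -
  have "(\<lambda>_. \<one>\<^bsub>\<Gamma>'\<^esub>, v) \<in> \<theta> ` carrier dom.QV"
    using theta_bij assms by (simp add: bij_betw_def cod.QV_carrier)
  then obtain p where "p \<in> carrier dom.QV" "(\<lambda>_. \<one>\<^bsub>\<Gamma>'\<^esub>, v) = \<theta> p" by blast
  then show ?thesis using that by (metis quot_def snd_conv)
qed

lemma V_in_QV [simp]: "v \<in> thompsonV \<Longrightarrow> (\<lambda>_. \<one>\<^bsub>\<Gamma>\<^esub>, v) \<in> carrier dom.QV"
  by (simp add: dom.QV_carrier)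

text \<open>Conjugates of \<open>\<Gamma>\<^sub>x\<close> that move \<open>x\<close> commute with \<open>\<Gamma>\<^sub>x\<close>, whereas a nontrivial element of
  \<open>V\<close> has many conjugates not commuting with it.\<close>

lemma quot_single:
  assumes x: "x \<in> Q2" and g: "g \<in> carrier \<Gamma>"
  shows "quot (dom.single x g, id) = id"
proof (rule ccontr)
  let ?s = "(dom.single x g, id)"
  define u where "u = quot ?s"
  assume "\<not> ?thesis"
  then have "u \<noteq> id" by (simp add: u_def)
  have u: "u \<in> thompsonV" unfolding u_def using assms by (simp add: quot_thompsonV)
  \<comment> \<open>Conjugation by \<open>k\<close> moves the summand at \<open>x\<close> to another
    summand, which commutes with it; \<open>quot\<close> transports the relation to
    \<open>V\<close>.\<close>
  have comm: "(quot k \<circ> u \<circ> vinv (quot k)) \<circ> u = u \<circ> (quot k \<circ> u \<circ> vinv (quot k))"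
    if k: "k \<in> carrier dom.QV" "snd k x \<noteq> x" for k
  proof -
    obtain a v where av: "k = (a, v)" "a \<in> fin_supp \<Gamma>" "v \<in> thompsonV"
      using k(1) by (auto simp: dom.QV_carrier)
    define g' where "g' = a (v x) \<otimes>\<^bsub>\<Gamma>\<^esub> dom.ap (log_slope v x) g \<otimes>\<^bsub>\<Gamma>\<^esub> inv\<^bsub>\<Gamma>\<^esub> a (v x)"
    let ?s' = "(dom.single (v x) g', id)"
    have g': "g' \<in> carrier \<Gamma>" unfolding g'_def using av g by simp
    have s': "?s' \<in> carrier dom.QV" using g' x thompsonV_Q2_iff [OF av(3)] by simp
    have "k \<otimes>\<^bsub>dom.QV\<^esub> ?s = ?s' \<otimes>\<^bsub>dom.QV\<^esub> k"
      using dom.conj_single [OF av(2,3) g, of x] by (simp add: av(1) g'_def)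
    then have "quot k \<circ> u = quot ?s' \<circ> quot k"
      unfolding u_def using quot_mult k(1) s' assms by (metis dom.single_QV)
    then have q: "quot k \<circ> u \<circ> vinv (quot k) = quot ?s'"
      using quot_thompsonV [OF k(1)] by (simp add: comp_assoc)
    have "?s' \<otimes>\<^bsub>dom.QV\<^esub> ?s = ?s \<otimes>\<^bsub>dom.QV\<^esub> ?s'"
      using dom.single_commute [OF g' g] k(2) av(1) by simp
    then have "quot ?s' \<circ> u = u \<circ> quot ?s'"
      unfolding u_def using quot_mult s' assms by (metis dom.single_QV)
    then show ?thesis using q by simp
  qed
  obtain x' where x': "x' \<in> Q2" "x' \<noteq> x" using exists_fresh_Q2 [of "{x}"] by auto
  obtain v0 where v0: "v0 \<in> thompsonV" "map v0 [x] = [x']"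
    by (rule thompsonV_highly_transitive_list [of "[x]" "[x']"]) (use x x' in auto)
  let ?h0 = "(\<lambda>_. \<one>\<^bsub>\<Gamma>\<^esub>, v0)"
  define v where "v = quot ?h0"
  have v: "v \<in> thompsonV" unfolding v_def using v0(1) by (simp add: quot_thompsonV)
  have "vinv v \<circ> u \<circ> v \<in> thompsonV" using u v by (simp add: thompsonV_comp thompsonV_vinv)
  moreover have "vinv v \<circ> u \<circ> v \<noteq> id"
  proof
    assume eq: "vinv v \<circ> u \<circ> v = id"
    have "u z = z" for z
    proof -
      have "vinv v (u z) = vinv v z" using fun_cong [OF eq, of "vinv v z"] v by simp
      then show ?thesis by (metis thompsonV_apply_vinv [OF v])
    qed
    then show False using \<open>u \<noteq> id\<close> by (auto simp: fun_eq_iff)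
  qed
  \<comment> \<open>A single \<open>w\<close> has to work for \<open>u\<close> and for its conjugate
    by \<open>v\<close>: the first excludes that a lift \<open>h\<close> of \<open>w\<close> moves
    \<open>x\<close>, the second that it fixes \<open>x\<close>, since then \<open>?h0\<close> times
    \<open>h\<close> moves \<open>x\<close>.\<close>
  ultimately obtain w where w: "w \<in> thompsonV"
    and nc1: "(w \<circ> u \<circ> vinv w) \<circ> u \<noteq> u \<circ> (w \<circ> u \<circ> vinv w)"
    and nc2: "(w \<circ> u \<circ> vinv w) \<circ> (vinv v \<circ> u \<circ> v) \<noteq> (vinv v \<circ> u \<circ> v) \<circ> (w \<circ> u \<circ> vinv w)"
    by (rule thompsonV_conj_not_commuting [OF u \<open>u \<noteq> id\<close> u \<open>u \<noteq> id\<close>])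
  obtain h where h: "h \<in> carrier dom.QV" "quot h = w" by (rule quot_surj [OF w])
  have "snd h x = x" using comm [OF h(1)] nc1 h(2) by blast
  then have "snd (?h0 \<otimes>\<^bsub>dom.QV\<^esub> h) x \<noteq> x"
    using v0(2) x' by (cases h) (simp add: dom.QV_mult)
  moreover have "?h0 \<otimes>\<^bsub>dom.QV\<^esub> h \<in> carrier dom.QV"
    using group.is_monoid [OF dom.QV_group] h(1) v0(1) by (simp add: monoid.m_closed)
  moreover have "quot (?h0 \<otimes>\<^bsub>dom.QV\<^esub> h) = v \<circ> w"
    using quot_mult [of ?h0 h] h v0(1) by (simp add: v_def)
  ultimately have c: "((v \<circ> w) \<circ> u \<circ> vinv (v \<circ> w)) \<circ> u = u \<circ> ((v \<circ> w) \<circ> u \<circ> vinv (v \<circ> w))"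
    using comm by metis
  \<comment> \<open>This is \<open>c\<close> conjugated by \<open>vinv v\<close>.\<close>
  have "((w \<circ> u \<circ> vinv w) \<circ> (vinv v \<circ> u \<circ> v)) z = ((vinv v \<circ> u \<circ> v) \<circ> (w \<circ> u \<circ> vinv w)) z" for z
  proof -
    have "v (w (u (vinv w (vinv v (u (v z)))))) = u (v (w (u (vinv w (vinv v (v z))))))"
      using fun_cong [OF c, of "v z"] v w by (simp only: vinv_comp comp_apply)
    then have "w (u (vinv w (vinv v (u (v z))))) = vinv v (u (v (w (u (vinv w z)))))"
      using v by (metis thompsonV_vinv_apply)
    then show ?thesis by simp
  qed
  then show False using nc2 by blast
qed

text \<open>A finitely supported function is a product of elements supported at single points,
  peeled off one at a time.\<close>

lemma quot_base:
  assumes "a \<in> fin_supp \<Gamma>"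
  shows "quot (a, id) = id"
proof -
  have "quot (a, id) = id" if "finite F" "a \<in> fin_supp \<Gamma>" "{x. a x \<noteq> \<one>\<^bsub>\<Gamma>\<^esub>} \<subseteq> F" for F a
    using that
  proof (induction F arbitrary: a rule: finite_induct)
    case empty
    then have "a = (\<lambda>_. \<one>\<^bsub>\<Gamma>\<^esub>)" by auto
    then show ?case using theta_one by (simp only: quot_def snd_conv)
  next
    case (insert x F)
    show ?case
    proof (cases "x \<in> Q2")
      case True
      let ?s = "dom.single x (a x)" and ?b = "a(x := \<one>\<^bsub>\<Gamma>\<^esub>)"
      have sub: "{y. ?b y \<noteq> \<one>\<^bsub>\<Gamma>\<^esub>} \<subseteq> F" using insert.prems by auto
      have b: "?b \<in> fin_supp \<Gamma>"
        by (rule dom.fin_suppI)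
          (use insert.prems dom.fin_supp_outside finite_subset [OF sub insert.hyps(1)] in auto)
      have "(a, id) = (?s, id) \<otimes>\<^bsub>dom.QV\<^esub> (?b, id)"
        using insert.prems by (auto simp: dom.QV_mult dom.single_def)
      moreover have "(?s, id) \<in> carrier dom.QV" "(?b, id) \<in> carrier dom.QV"
        using True b insert.prems by (simp_all add: dom.QV_carrier thompsonV_id)
      ultimately have "quot (a, id) = quot (?s, id) \<circ> quot (?b, id)"
        using quot_mult by metis
      also have "quot (?s, id) = id"
        by (rule quot_single [OF True]) (use insert.prems in simp)
      also have "quot (?b, id) = id" by (rule insert.IH [OF b sub])
      finally show ?thesis by (simp only: comp_id)
    next
      case False
      then have "a x = \<one>\<^bsub>\<Gamma>\<^esub>" using insert.prems(1) dom.fin_supp_outside by blast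
      then have "{x. a x \<noteq> \<one>\<^bsub>\<Gamma>\<^esub>} \<subseteq> F" using insert.prems(2) by auto
      then show ?thesis using insert by blast
    qed
  qed
  then show ?thesis using assms dom.fin_supp_finite by blast
qed

lemma quot_eq_phi:
  assumes "a \<in> fin_supp \<Gamma>" "v \<in> thompsonV"
  shows "quot (a, v) = phi v"
proof -
  have "(a, v) = (a, id) \<otimes>\<^bsub>dom.QV\<^esub> (\<lambda>_. \<one>\<^bsub>\<Gamma>\<^esub>, v)"
    using assms by (simp add: dom.QV_mult)
  then have "quot (a, v) = quot (a, id) \<circ> quot (\<lambda>_. \<one>\<^bsub>\<Gamma>\<^esub>, v)"
    using assms quot_mult [of "(a, id)" "(\<lambda>_. \<one>\<^bsub>\<Gamma>\<^esub>, v)"] by (simp add: dom.QV_carrier thompsonV_id)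
  then show ?thesis using quot_base [OF assms(1)] by (simp add: phi_def)
qed

lemma phi_thompsonV: "v \<in> thompsonV \<Longrightarrow> phi v \<in> thompsonV"
  by (simp add: phi_def quot_thompsonV)

lemma phi_comp:
  assumes "v \<in> thompsonV" "w \<in> thompsonV"
  shows "phi (v \<circ> w) = phi v \<circ> phi w"
  unfolding phi_def using quot_mult [of "(\<lambda>_. \<one>\<^bsub>\<Gamma>\<^esub>, v)" "(\<lambda>_. \<one>\<^bsub>\<Gamma>\<^esub>, w)"] assms
  by (simp add: dom.QV_mult)

lemma phi_id: "phi id = id"
  using quot_base [of "\<lambda>_. \<one>\<^bsub>\<Gamma>\<^esub>"] by (simp add: phi_def)

lemma phi_funpow: "v \<in> thompsonV \<Longrightarrow> phi (v ^^ n) = phi v ^^ n"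
  by (induction n) (auto simp: phi_id phi_comp thompsonV_funpow)

lemma phi_vinv:
  assumes "v \<in> thompsonV"
  shows "phi (vinv v) = vinv (phi v)"
proof -
  have "phi (vinv v) (phi v x) = x" for x
    using phi_comp [OF thompsonV_vinv [OF assms] assms] phi_id assms
    by (metis comp_apply id_apply thompsonV_vinv_comp)
  then show ?thesis
    using phi_thompsonV [OF assms] by (metis ext thompsonV_apply_vinv)
qed

lemma theta_V:
  assumes "v \<in> thompsonV"
  obtains c where "c \<in> fin_supp \<Gamma>'" "\<theta> (\<lambda>_. \<one>\<^bsub>\<Gamma>\<^esub>, v) = (c, phi v)"
  using theta_closed [OF V_in_QV [OF assms]] that
  by (cases "\<theta> (\<lambda>_. \<one>\<^bsub>\<Gamma>\<^esub>, v)") (auto simp: phi_def quot_def cod.QV_carrier)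

lemma theta_base:
  assumes "a \<in> fin_supp \<Gamma>"
  obtains b where "b \<in> fin_supp \<Gamma>'" "\<theta> (a, id) = (b, id)"
proof -
  have "(a, id) \<in> carrier dom.QV" using assms by (simp add: dom.QV_carrier thompsonV_id)
  from theta_closed [OF this] quot_base [OF assms] that show ?thesis
    by (cases "\<theta> (a, id)") (auto simp: quot_def cod.QV_carrier)
qed

section \<open>Supports of the images of elements supported at one point\<close>

text \<open>As \<open>e\<close> fixes \<open>x\<close> with slope one, it commutes with the summand
  at \<open>x\<close>. After applying \<theta>, the values of \<open>b\<close> at \<open>z\<close>
  and \<open>phi e z\<close> agree up to a power of \<alpha>' and a conjugation, which preserve
  being the identity.\<close>

lemma support_invariant:
  assumes x: "x \<in> Q2" and g: "g \<in> carrier \<Gamma>" and b: "b \<in> fin_supp \<Gamma>'" "\<theta> (dom.single x g, id) = (b, id)"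
    and e: "e \<in> tangent_stab x"
  shows "b (phi e z) = \<one>\<^bsub>\<Gamma>'\<^esub> \<longleftrightarrow> b z = \<one>\<^bsub>\<Gamma>'\<^esub>"
proof -
  have eV: "e \<in> thompsonV" "e x = x" "log_slope e x = 0" using e by (auto simp: tangent_stab_def)
  obtain c where c: "c \<in> fin_supp \<Gamma>'" "\<theta> (\<lambda>_. \<one>\<^bsub>\<Gamma>\<^esub>, e) = (c, phi e)" by (rule theta_V [OF eV(1)])
  have "(\<lambda>_. \<one>\<^bsub>\<Gamma>\<^esub>, e) \<otimes>\<^bsub>dom.QV\<^esub> (dom.single x g, id) = (dom.single x g, id) \<otimes>\<^bsub>dom.QV\<^esub> (\<lambda>_. \<one>\<^bsub>\<Gamma>\<^esub>, e)"
    using dom.conj_single [of "\<lambda>_. \<one>\<^bsub>\<Gamma>\<^esub>" e g x] eV g by simp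
  then have "(c, phi e) \<otimes>\<^bsub>cod.QV\<^esub> (b, id) = (b, id) \<otimes>\<^bsub>cod.QV\<^esub> (c, phi e)"
    using theta_mult x g eV(1) b(2) c(2) by (metis V_in_QV dom.single_QV)
  then have "c (phi e z) \<otimes>\<^bsub>\<Gamma>'\<^esub> cod.act (phi e) b (phi e z) = b (phi e z) \<otimes>\<^bsub>\<Gamma>'\<^esub> c (phi e z)"
    by (simp add: cod.QV_mult) metis
  moreover have "cod.act (phi e) b (phi e z) = cod.ap (log_slope (phi e) z) (b z)"
    by (rule cod.act_apply [OF phi_thompsonV [OF eV(1)]])
  ultimately have "c (phi e z) \<otimes>\<^bsub>\<Gamma>'\<^esub> cod.ap (log_slope (phi e) z) (b z) = b (phi e z) \<otimes>\<^bsub>\<Gamma>'\<^esub> c (phi e z)"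
    by simp
  then have "cod.ap (log_slope (phi e) z) (b z) = \<one>\<^bsub>\<Gamma>'\<^esub> \<longleftrightarrow> b (phi e z) = \<one>\<^bsub>\<Gamma>'\<^esub>"
    using b(1) c(1) cod.fin_supp_closed
    by (metis cod.ap_closed cod.l_cancel_one cod.r_cancel_one)
  then show ?thesis using b(1) cod.ap_eq_one_iff by simp
qed

text \<open>Take a root \<open>e\<close> of \<open>d\<close> whose order is the factorial of the
  size of the support: \<open>phi e\<close> permutes the support, so its power \<open>phi d\<close>
  fixes it pointwise.\<close>

lemma support_fixed:
  assumes x: "x \<in> Q2" and g: "g \<in> carrier \<Gamma>" and b: "b \<in> fin_supp \<Gamma>'" "\<theta> (dom.single x g, id) = (b, id)"
    and d: "d \<in> divisible_stab x" and z: "b z \<noteq> \<one>\<^bsub>\<Gamma>'\<^esub>"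
  shows "phi d z = z"
proof -
  let ?S = "{z. b z \<noteq> \<one>\<^bsub>\<Gamma>'\<^esub>}"
  have "1 \<le> (fact (card ?S) :: nat)" by simp
  moreover have "\<forall>n\<ge>1. \<exists>e\<in>tangent_stab x. e ^^ n = d"
    using d unfolding divisible_stab_def mem_Collect_eq by (rule conjunct2)
  ultimately obtain e where e: "e \<in> tangent_stab x" "e ^^ fact (card ?S) = d" by blast
  have eV: "e \<in> thompsonV" using e by (simp add: tangent_stab_def)
  have "(phi e ^^ fact (card ?S)) z = z"
  proof (rule funpow_fact_card)
    show "finite ?S" by (rule cod.fin_supp_finite [OF b(1)])
    show "inj (phi e)" using phi_thompsonV [OF eV] by (simp add: thompsonV_bij bij_is_inj)
    show "phi e ` ?S \<subseteq> ?S" using support_invariant [OF x g b e(1)] by auto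
  qed (use z in simp)
  then show ?thesis using phi_funpow [OF eV] e(2) by metis
qed

end

context QV_iso
begin

text \<open>Since the quotient maps ignore the direct sum, the component \<open>c\<close> does not
  matter, and inverse isomorphisms induce inverse maps on \<open>V\<close>.\<close>

lemma phi_inverse:
  assumes "QV_iso \<Gamma>' \<alpha>' \<Gamma> \<alpha> \<theta>'" "\<And>p. p \<in> carrier dom.QV \<Longrightarrow> \<theta>' (\<theta> p) = p" "v \<in> thompsonV"
  shows "QV_iso.phi \<Gamma>' \<theta>' (phi v) = v"
proof -
  interpret J: QV_iso \<Gamma>' \<alpha>' \<Gamma> \<alpha> \<theta>' by fact
  obtain c where c: "c \<in> fin_supp \<Gamma>'" "\<theta> (\<lambda>_. \<one>\<^bsub>\<Gamma>\<^esub>, v) = (c, phi v)" by (rule theta_V [OF assms(3)])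
  have "J.phi (phi v) = J.quot (\<theta> (\<lambda>_. \<one>\<^bsub>\<Gamma>\<^esub>, v))"
    using J.quot_eq_phi [OF c(1) phi_thompsonV [OF assms(3)]] c(2) by simp
  then show ?thesis using assms(2) [OF V_in_QV [OF assms(3)]] by (simp add: J.quot_def)
qed

lemma inverse_iso: "QV_iso \<Gamma>' \<alpha>' \<Gamma> \<alpha> (inv_into (carrier dom.QV) \<theta>)"
  using group.iso_set_sym [OF dom.QV_group iso] by (unfold_locales) auto

lemma theta_left_inverse: "p \<in> carrier dom.QV \<Longrightarrow> inv_into (carrier dom.QV) \<theta> (\<theta> p) = p"
  by (rule bij_betw_inv_into_left [OF theta_bij])

lemma theta_right_inverse: "p \<in> carrier cod.QV \<Longrightarrow> \<theta> (inv_into (carrier dom.QV) \<theta> p) = p"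
  by (rule bij_betw_inv_into_right [OF theta_bij])

lemma phi_eq_idD:
  assumes "d \<in> thompsonV" "phi d = id"
  shows "d = id"
  using phi_inverse [OF inverse_iso theta_left_inverse] assms phi_id thompsonV_id by metis

lemma phi_surj: "v \<in> thompsonV \<Longrightarrow> \<exists>w\<in>thompsonV. phi w = v"
  using quot_surj quot_eq_phi by (metis SigmaE dom.QV_carrier)

section \<open>The bijection between dyadic points\<close>

text \<open>The graph of the point map induced by \<theta>, expressed through \<open>phi\<close>
  alone. Existence will come from supports, uniqueness from transitivity.\<close>

definition fixes_image :: "cantor \<Rightarrow> cantor \<Rightarrow> bool" where
  "fixes_image x z \<longleftrightarrow> x \<in> Q2 \<and> z \<in> Q2 \<and> (\<forall>d\<in>divisible_stab x. phi d z = z)"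

lemma fixes_image_equivariant:
  assumes "fixes_image x z" "v \<in> thompsonV"
  shows "fixes_image (v x) (phi v z)"
proof -
  have "phi d (phi v z) = phi v z" if d: "d \<in> divisible_stab (v x)" for d
  proof -
    have dV: "d \<in> thompsonV" using d by (simp add: divisible_stab_def tangent_stab_def)
    let ?d = "vinv v \<circ> d \<circ> v"
    have "?d \<in> divisible_stab x"
      using divisible_stab_conj [OF d thompsonV_vinv [OF assms(2)]] assms(2) by (simp add: vinv_vinv)
    then have "phi ?d z = z" using assms(1) by (simp add: fixes_image_def)
    moreover have "phi ?d = vinv (phi v) \<circ> phi d \<circ> phi v"
      using dV assms(2) by (simp add: phi_comp phi_vinv thompsonV_comp thompsonV_vinv)
    ultimately show ?thesis
      using thompsonV_apply_vinv [OF phi_thompsonV [OF assms(2)]] by (metis comp_apply)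
  qed
  then show ?thesis
    using assms thompsonV_Q2_iff [OF assms(2)] thompsonV_Q2_iff [OF phi_thompsonV [OF assms(2)]]
    by (simp add: fixes_image_def)
qed

text \<open>Were \<open>z\<close> attached to two points, transitivity of
  \<open>divisible_stab x\<close> would attach it to all. As \<open>phi\<close> is onto and
  \<open>V\<close> is transitive, every pair would then be related, and a nontrivial
  \<open>d\<close> would have trivial image.\<close>

lemma fixes_image_unique:
  assumes x: "fixes_image x z" and y: "fixes_image y z"
  shows "x = y"
proof (rule ccontr)
  assume ne: "x \<noteq> y"
  have Q: "x \<in> Q2" "y \<in> Q2" "z \<in> Q2" using x y by (auto simp: fixes_image_def)
  have all: "fixes_image y' z" if y': "y' \<in> Q2" for y'
  proof (cases "y' = x \<or> y' = y")
    case True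
    then show ?thesis using x y by auto
  next
    case False
    then obtain d where d: "d \<in> divisible_stab x" "d y = y'"
      using divisible_stab_transitive [of x y y'] Q ne y' by auto
    then have "d \<in> thompsonV" by (simp add: divisible_stab_def tangent_stab_def)
    from fixes_image_equivariant [OF y this] show ?thesis
      using d x by (simp add: fixes_image_def)
  qed
  obtain d where d: "d \<in> divisible_stab x" "d \<noteq> id" using divisible_stab_nontrivial by blast
  then have dV: "d \<in> thompsonV" by (simp add: divisible_stab_def tangent_stab_def)
  have "phi d z' = z'" if z': "z' \<in> Q2" for z'
  proof -
    obtain u where u: "u \<in> thompsonV" "map u [z] = [z']"
      by (rule thompsonV_highly_transitive_list [of "[z]" "[z']"]) (use z' Q in auto)
    obtain v where v: "v \<in> thompsonV" "phi v = u" using phi_surj [OF u(1)] by blast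
    have "fixes_image (vinv v x) z" using Q v by (intro all) simp
    from fixes_image_equivariant [OF this v(1)] have "fixes_image x z'" using v u by simp
    then show ?thesis using d(1) by (simp add: fixes_image_def)
  qed
  then have "phi d = id" using thompsonV_eq_id [OF phi_thompsonV [OF dV]] by blast
  then show False using phi_eq_idD [OF dV] d(2) by blast
qed

text \<open>By \<open>stab\<close> the finite support of the image is invariant under
  \<open>tangent_stab y\<close>, which is transitive on the other dyadic points; a support point
  other than \<open>y\<close> would bring infinitely many.\<close>

lemma theta_single:
  assumes x: "x \<in> Q2" and y: "y \<in> Q2" and g: "g \<in> carrier \<Gamma>"
    and stab: "\<And>w. w \<in> tangent_stab y \<Longrightarrow> \<exists>e\<in>tangent_stab x. phi e = w"
  shows "\<exists>g'\<in>carrier \<Gamma>'. \<theta> (dom.single x g, id) = (cod.single y g', id)"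
proof -
  obtain b where b: "b \<in> fin_supp \<Gamma>'" "\<theta> (dom.single x g, id) = (b, id)"
    by (rule theta_base [OF dom.single_fin_supp [OF x g]])
  have "b z = \<one>\<^bsub>\<Gamma>'\<^esub>" if "z \<noteq> y" for z
  proof (rule ccontr)
    assume bz: "b z \<noteq> \<one>\<^bsub>\<Gamma>'\<^esub>"
    then have z: "z \<in> Q2" using cod.fin_supp_outside [OF b(1)] by blast
    have "b z' \<noteq> \<one>\<^bsub>\<Gamma>'\<^esub>" if z': "z' \<in> Q2" "z' \<noteq> y" for z'
    proof -
      obtain w where "w \<in> tangent_stab y" "w z = z'"
        using tangent_stab_transitive [OF y z \<open>z \<noteq> y\<close> z'] by blast
      then show ?thesis using stab support_invariant [OF x g b] bz by blast
    qed
    then have "Q2 \<subseteq> insert y {z. b z \<noteq> \<one>\<^bsub>\<Gamma>'\<^esub>}" by blast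
    then show False using infinite_Q2 cod.fin_supp_finite [OF b(1)] by (meson finite.insertI finite_subset)
  qed
  then have "b = cod.single y (b y)" by (auto simp: cod.single_def)
  then show ?thesis using b cod.fin_supp_closed [OF b(1)] by metis
qed

text \<open>If \<Gamma> is trivial, the inverse isomorphism sends each element supported at one
  point to the identity. This settles the degenerate case and makes nontriviality symmetric in the
  two groups.\<close>

lemma trivial_imp_trivial:
  assumes "\<And>g. g \<in> carrier \<Gamma> \<Longrightarrow> g = \<one>\<^bsub>\<Gamma>\<^esub>" "g' \<in> carrier \<Gamma>'"
  shows "g' = \<one>\<^bsub>\<Gamma>'\<^esub>"
proof -
  interpret I: QV_iso \<Gamma>' \<alpha>' \<Gamma> \<alpha> "inv_into (carrier dom.QV) \<theta>" by (rule inverse_iso)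
  obtain x where x: "x \<in> Q2" using exists_fresh_Q2 [of "{}"] by auto
  obtain b where b: "b \<in> fin_supp \<Gamma>" "inv_into (carrier dom.QV) \<theta> (cod.single x g', id) = (b, id)"
    by (rule I.theta_base [OF cod.single_fin_supp [OF x assms(2)]])
  have "b = (\<lambda>_. \<one>\<^bsub>\<Gamma>\<^esub>)" using assms(1) dom.fin_supp_closed [OF b(1)] by (intro ext) blast
  then have "cod.single x g' = (\<lambda>_. \<one>\<^bsub>\<Gamma>'\<^esub>)"
    using theta_right_inverse [OF cod.single_QV [OF x assms(2)]] b(2) theta_one by simp
  then have "cod.single x g' x = \<one>\<^bsub>\<Gamma>'\<^esub>" by simp
  then show ?thesis by (simp add: cod.single_def)
qed

end

locale QV_iso_nontrivial = QV_iso +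
  assumes nontrivial: "\<exists>g\<in>carrier \<Gamma>. g \<noteq> \<one>\<^bsub>\<Gamma>\<^esub>"
begin

text \<open>By injectivity of \<theta> the image of a nonidentity element at \<open>x\<close> has
  nonempty support, and \<open>support_fixed\<close> shows that any point of it will do.\<close>

lemma fixes_image_right: 
  assumes x: "x \<in> Q2"
  shows "\<exists>z. fixes_image x z"
proof -
  obtain g where g: "g \<in> carrier \<Gamma>" "g \<noteq> \<one>\<^bsub>\<Gamma>\<^esub>" using nontrivial by blast
  obtain b where b: "b \<in> fin_supp \<Gamma>'" "\<theta> (dom.single x g, id) = (b, id)"
    by (rule theta_base [OF dom.single_fin_supp [OF x g(1)]])
  have "\<exists>z. b z \<noteq> \<one>\<^bsub>\<Gamma>'\<^esub>"
  proof (rule ccontr)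
    assume "\<not> ?thesis"
    then have "b = (\<lambda>_. \<one>\<^bsub>\<Gamma>'\<^esub>)" by (intro ext) blast
    then have eq: "\<theta> (dom.single x g, id) = \<theta> (\<lambda>_. \<one>\<^bsub>\<Gamma>\<^esub>, id)"
      using b(2) theta_one by (simp only:)
    have "dom.single x g = (\<lambda>_. \<one>\<^bsub>\<Gamma>\<^esub>)"
      using inj_onD [OF bij_betw_imp_inj_on [OF theta_bij] eq
          dom.single_QV [OF x g(1)] V_in_QV [OF thompsonV_id]] by simp
    then have "dom.single x g x = \<one>\<^bsub>\<Gamma>\<^esub>" by simp
    then show False using g(2) by (simp add: dom.single_def)
  qed
  then obtain z where z: "b z \<noteq> \<one>\<^bsub>\<Gamma>'\<^esub>" ..
  then have "z \<in> Q2" using cod.fin_supp_outside [OF b(1)] by blast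
  then show ?thesis
    using support_fixed [OF x g(1) b _ z] x unfolding fixes_image_def by blast
qed

text \<open>One related pair is enough: \<open>V\<close> is transitive, and \<open>phi\<close> is
  onto.\<close>

lemma fixes_image_left:
  assumes z: "z \<in> Q2"
  shows "\<exists>x. fixes_image x z"
proof -
  obtain x0 where x0: "x0 \<in> Q2" using exists_fresh_Q2 [of "{}"] by auto
  obtain z0 where z0: "fixes_image x0 z0" using fixes_image_right [OF x0] ..
  then have "z0 \<in> Q2" by (simp add: fixes_image_def)
  then obtain u where u: "u \<in> thompsonV" "map u [z0] = [z]"
    by (rule_tac thompsonV_highly_transitive_list [of "[z0]" "[z]"]) (use z in auto)
  obtain v where v: "v \<in> thompsonV" "phi v = u" using phi_surj [OF u(1)] by blast
  show ?thesis using fixes_image_equivariant [OF z0 v(1)] v u by auto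
qed

text \<open>Uniqueness was obtained for \<open>x\<close> given \<open>z\<close>, so
  \<open>pt\<close> runs from the target back to the source; the map in the other direction will be
  \<open>pt\<close> for the inverse isomorphism.\<close>

definition pt :: "cantor \<Rightarrow> cantor" where
  "pt z = (THE x. fixes_image x z)"

lemma pt_eqI: "fixes_image x z \<Longrightarrow> pt z = x"
  unfolding pt_def using fixes_image_unique by blast

lemma fixes_image_pt: "z \<in> Q2 \<Longrightarrow> fixes_image (pt z) z"
  using fixes_image_left pt_eqI by blast

lemma pt_Q2: "z \<in> Q2 \<Longrightarrow> pt z \<in> Q2"
  using fixes_image_pt by (simp add: fixes_image_def)

lemma pt_equivariant: "v \<in> thompsonV \<Longrightarrow> z \<in> Q2 \<Longrightarrow> pt (phi v z) = v (pt z)"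
  by (intro pt_eqI fixes_image_equivariant fixes_image_pt)

end

section \<open>Slopes at fixed points\<close>

text \<open>A standard element of Thompson's group F: \<open>00\<close> goes to \<open>0\<close>,
  \<open>01\<close> to \<open>10\<close> and \<open>1\<close> to \<open>11\<close>. It fixes the
  zero sequence with slope two.\<close>

definition expand_zero :: "cantor \<Rightarrow> cantor" where
  "expand_zero y = (\<lambda>n. if y 0 then (if n = 0 then True else if n = 1 then True else y (n - 1))
     else if y 1 then (if n = 0 then True else if n = 1 then False else y n)
     else (if n = 0 then False else y (n + 1)))"

lemma expand_zero_bij: "bij expand_zero"
proof (rule o_bij)
  define e' :: "cantor \<Rightarrow> cantor" where
    "e' y = (\<lambda>n. if \<not> y 0 then (if n = 0 then False else y (n - 1))
      else if y 1 then (if n = 0 then True else y (n + 1))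
      else (if n = 0 then False else if n = 1 then True else y n))" for y
  have one: "n = Suc 0" if "n \<le> Suc 0" "0 < n" for n using that by simp
  show "e' \<circ> expand_zero = id"
    unfolding e'_def expand_zero_def by (intro ext) (auto dest: one)
  show "expand_zero \<circ> e' = id"
    unfolding e'_def expand_zero_def by (intro ext) auto
qed

lemma expand_zero_acts_by:
  "acts_by expand_zero [False, False] [False]"
  "acts_by expand_zero [False, True] [True, False]"
  "acts_by expand_zero [True, b] [True, True, b]"
  by (auto simp: acts_by_def expand_zero_def concat_word_def nth_Cons' fun_eq_iff numeral_2_eq_2)

lemma expand_zero_thompsonV: "expand_zero \<in> thompsonV"
  unfolding thompsonV_iff
proof (intro conjI expand_zero_bij exI [of _ 2] allI impI)
  fix m :: "bool list" assume "length m = 2"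
  then obtain a b where m: "m = [a, b]" by (auto simp: numeral_2_eq_2 length_Suc_conv)
  show "\<exists>m'. acts_by expand_zero m m'"
    unfolding m by (cases a; cases b) (auto intro: expand_zero_acts_by)
qed

lemma exists_slope_two:
  assumes "y \<in> Q2"
  shows "\<exists>v\<in>thompsonV. v y = y \<and> log_slope v y = 1"
proof -
  let ?o = "\<lambda>_ :: nat. False"
  have o: "?o = [False, False] @@ ?o" "[False] @@ ?o = ?o"
    by (auto simp: concat_word_def nth_Cons' fun_eq_iff)
  have fx: "expand_zero ?o = ?o" by (simp add: expand_zero_def)
  have slope: "log_slope expand_zero ?o = 1"
    using log_slope_eq [OF expand_zero_acts_by(1), of ?o] o(1) by simp
  have "?o \<in> Q2" by (simp add: Q2_def)
  then obtain w where w: "w \<in> thompsonV" "map w [?o] = [y]" "\<And>x. log_slope w x = 0"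
    by (rule_tac thompsonV_highly_transitive_list [of "[?o]" "[y]"]) (use assms in auto)
  have y: "y = w ?o" using w(2) by simp
  have "log_slope (w \<circ> expand_zero \<circ> vinv w) y = 1"
    unfolding y using w(1,3) fx slope log_slope_vinv [OF w(1), of ?o]
    by (simp add: log_slope_comp thompsonV_comp thompsonV_vinv expand_zero_thompsonV)
  moreover have "(w \<circ> expand_zero \<circ> vinv w) y = y"
    unfolding y using w(1) fx by simp
  ultimately show ?thesis
    using thompsonV_comp thompsonV_vinv expand_zero_thompsonV w(1) by blast
qed

text \<open>Suppose that \<phi> \<open>v\<close> expands at \<sigma> \<open>x\<close>. Continuity of
  \<sigma> at \<open>x\<close> is extracted from supports: some \<open>u\<close> supported near
  \<sigma> \<open>x\<close> comes from a \<open>w\<close> that moves a neighbourhood of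
  \<open>x\<close>. As \<open>v\<close> does not expand, a nearby \<open>y\<close> keeps its orbit
  in that neighbourhood, so the orbit of \<sigma> \<open>y\<close> stays where \<phi>
  \<open>v\<close> expands, which forces it to be the fixed point. The maps are left abstract to
  serve an isomorphism and its inverse alike.\<close>

lemma spatial_nonexpanding:
  assumes phi: "\<And>v. v \<in> thompsonV \<Longrightarrow> \<phi> v \<in> thompsonV"
    and phi': "\<And>v. v \<in> thompsonV \<Longrightarrow> \<exists>w\<in>thompsonV. \<phi> w = v"
    and sig: "\<And>x. x \<in> Q2 \<Longrightarrow> \<sigma> x \<in> Q2" "inj_on \<sigma> Q2"
    and equiv: "\<And>v x. v \<in> thompsonV \<Longrightarrow> x \<in> Q2 \<Longrightarrow> \<phi> v (\<sigma> x) = \<sigma> (v x)"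
    and v: "v \<in> thompsonV" and x: "x \<in> Q2" and vx: "v x = x" and slope: "log_slope v x \<le> 0"
  shows "log_slope (\<phi> v) (\<sigma> x) \<le> 0"
proof (rule ccontr)
  assume neg: "\<not> ?thesis"
  obtain n n' t where n: "\<sigma> x = n @@ t" "acts_by (\<phi> v) n n'"
    by (rule thompsonV_acts_byE [OF phi [OF v], of "\<sigma> x" 0])
  have "length n' < length n"
    using log_slope_eq [OF n(2), of t] neg n(1) by simp
  \<comment> \<open>This flips the digit \<open>length n\<close> on the cylinder of \<open>n\<close>
    and is the identity elsewhere.\<close>
  define u where "u = cyl_odometer (length n) (\<sigma> x) 0"
  have u: "u \<in> thompsonV" unfolding u_def by (rule level_perm_thompsonV [OF cyl_odometer_level_perm])
  have u_move: "u (\<sigma> x) \<noteq> \<sigma> x"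
  proof
    assume "u (\<sigma> x) = \<sigma> x"
    from fun_cong [OF this, of "length n"] show False by (simp add: u_def cyl_odometer_def)
  qed
  have u_supp: "\<exists>s. z = n @@ s" if "u z \<noteq> z" for z
  proof -
    have "\<forall>i<length n. z i = \<sigma> x i"
      using that unfolding u_def cyl_odometer_def by meson
    then have "prefix_word (length n) z = n"
      by (auto simp: prefix_word_def n concat_word_def intro!: nth_equalityI)
    then show ?thesis using in_cyl_prefix_word [of z "length n"] by (auto simp: cyl_def)
  qed
  obtain w where w: "w \<in> thompsonV" "\<phi> w = u" using phi' [OF u] by blast
  have "w x \<noteq> x" using equiv [OF w(1) x] u_move w(2) by metis
  then obtain M where M: "\<forall>y. (\<forall>i<M. y i = x i) \<longrightarrow> w y \<noteq> y"
    using thompsonV_moves_nbhd w(1) by blast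
  have nbhd: "\<exists>s. \<sigma> y = n @@ s" if "y \<in> Q2" "\<forall>i<M. y i = x i" for y
  proof (rule u_supp)
    have "w y \<noteq> y" using M that by blast
    then have "\<sigma> (w y) \<noteq> \<sigma> y"
      using sig(2) that(1) thompsonV_Q2_iff [OF w(1), of y] by (simp add: inj_on_eq_iff)
    then show "u (\<sigma> y) \<noteq> \<sigma> y" using equiv [OF w(1) that(1)] w(2) by simp
  qed
  obtain m m' s where m: "x = m @@ s" "acts_by v m m'" "M \<le> length m"
    by (rule thompsonV_acts_byE [OF v, of x M])
  \<comment> \<open>As \<open>x\<close> is fixed, the two words are nested, and the slope makes
    \<open>m'\<close> the longer one; hence \<open>v\<close> maps the cylinder of \<open>m\<close>
    into itself.\<close>
  have "length m \<le> length m'"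
    using log_slope_eq [OF m(2), of s] slope m(1) by simp
  moreover have "m @@ s = m' @@ s" using vx m by (simp add: acts_by_def)
  ultimately obtain r where r: "m' = m @ r" by (metis concat_word_prefixE)
  have "infinite {y \<in> Q2. \<forall>i<length m. y i = x i}" by (rule infinite_Q2_nbhd)
  then have "\<not> {y \<in> Q2. \<forall>i<length m. y i = x i} \<subseteq> {x}" using finite_subset by blast
  then obtain y where y: "y \<in> Q2" "\<forall>i<length m. y i = x i" "y \<noteq> x" by blast
  have "prefix_word (length m) y = m"
    using y(2) by (auto simp: prefix_word_def m concat_word_def intro!: nth_equalityI)
  then obtain s' where s': "y = m @@ s'"
    using in_cyl_prefix_word [of y "length m"] by (auto simp: cyl_def)
  have orbit: "(v ^^ k) y \<in> Q2 \<and> (\<exists>s. (v ^^ k) y = m @@ s) \<and> (\<phi> v ^^ k) (\<sigma> y) = \<sigma> ((v ^^ k) y)" for k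
  proof (induction k)
    case 0
    then show ?case using y s' by auto
  next
    case (Suc k)
    then obtain q where q: "(v ^^ k) y = m @@ q" by blast
    have "v (m @@ q) = m @@ (r @@ q)" using m(2) by (simp add: acts_by_def r concat_word_append)
    then show ?case
      using Suc q equiv [OF v, of "(v ^^ k) y"] thompsonV_Q2_iff [OF v, of "(v ^^ k) y"] by auto
  qed
  have "\<exists>s. (\<phi> v ^^ k) (\<sigma> y) = n @@ s" for k
  proof -
    obtain q where q: "(v ^^ k) y = m @@ q" "(v ^^ k) y \<in> Q2" using orbit by blast
    have "\<forall>i<M. (v ^^ k) y i = x i" using m(3) by (simp add: q(1) m(1) concat_word_less)
    then show ?thesis using nbhd [OF q(2)] orbit [of k] by simp
  qed
  moreover have "\<phi> v (n @@ t) = n @@ t" using equiv [OF v x] vx n(1) by simp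
  ultimately have "\<sigma> y = n @@ t"
    using expanding_fixpoint_unique [OF n(2) \<open>length n' < length n\<close>] by blast
  then have "\<sigma> y = \<sigma> x" using n(1) by simp
  then show False using y(1,3) x sig(2) by (simp add: inj_on_eq_iff)
qed

text \<open>The inverse element has the opposite logarithmic slope at the fixed point.\<close>

lemma spatial_nonexpanding_vinv:
  assumes phi: "\<And>v. v \<in> thompsonV \<Longrightarrow> \<phi> v \<in> thompsonV"
    and phi_surj: "\<And>v. v \<in> thompsonV \<Longrightarrow> \<exists>w\<in>thompsonV. \<phi> w = v"
    and phi_vinv: "\<And>v. v \<in> thompsonV \<Longrightarrow> \<phi> (vinv v) = vinv (\<phi> v)"
    and sig: "\<And>x. x \<in> Q2 \<Longrightarrow> \<sigma> x \<in> Q2" "inj_on \<sigma> Q2"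
    and equiv: "\<And>v x. v \<in> thompsonV \<Longrightarrow> x \<in> Q2 \<Longrightarrow> \<phi> v (\<sigma> x) = \<sigma> (v x)"
    and v: "v \<in> thompsonV" and x: "x \<in> Q2" and vx: "v x = x" and slope: "0 \<le> log_slope v x"
  shows "0 \<le> log_slope (\<phi> v) (\<sigma> x)"
proof -
  have "vinv v x = x" using vx thompsonV_vinv_apply [OF v, of x] by simp
  moreover have "log_slope (vinv v) x \<le> 0" using log_slope_vinv [OF v, of x] vx slope by simp
  ultimately have "log_slope (\<phi> (vinv v)) (\<sigma> x) \<le> 0"
    by (intro spatial_nonexpanding [OF phi phi_surj sig equiv thompsonV_vinv [OF v] x])
  moreover have "\<phi> v (\<sigma> x) = \<sigma> x" using equiv [OF v x] vx by simp
  ultimately show ?thesis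
    using log_slope_vinv [OF phi [OF v], of "\<sigma> x"] phi_vinv [OF v] by simp
qed

section \<open>Reading off the isomorphism between the two coefficient groups\<close>

lemma (in QV_iso) outer_conjugate:
  "\<exists>\<beta> \<in> iso \<Gamma> \<Gamma>'. \<exists>h \<in> carrier \<Gamma>'. \<forall>g \<in> carrier \<Gamma>'.
     \<alpha>' g = h \<otimes>\<^bsub>\<Gamma>'\<^esub> \<beta> (\<alpha> (inv_into (carrier \<Gamma>) \<beta> g)) \<otimes>\<^bsub>\<Gamma>'\<^esub> inv\<^bsub>\<Gamma>'\<^esub> h"
proof (cases "\<forall>g\<in>carrier \<Gamma>. g = \<one>\<^bsub>\<Gamma>\<^esub>")
  \<comment> \<open>Trivial groups offer no supports to work with; here the constant map is the
    isomorphism.\<close>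
  case True
  then have car: "carrier \<Gamma> = {\<one>\<^bsub>\<Gamma>\<^esub>}" by auto
  have "\<And>g'. g' \<in> carrier \<Gamma>' \<Longrightarrow> g' = \<one>\<^bsub>\<Gamma>'\<^esub>" using trivial_imp_trivial True by blast
  then have car': "carrier \<Gamma>' = {\<one>\<^bsub>\<Gamma>'\<^esub>}" by auto
  have "(\<lambda>_. \<one>\<^bsub>\<Gamma>'\<^esub>) \<in> iso \<Gamma> \<Gamma>'"
    by (auto simp: iso_def hom_def bij_betw_def car car')
  moreover have "\<alpha>' \<one>\<^bsub>\<Gamma>'\<^esub> = \<one>\<^bsub>\<Gamma>'\<^esub>" using cod.ap_one [of 1] by simp
  ultimately show ?thesis using car' by (auto intro!: bexI [of _ "\<lambda>_. \<one>\<^bsub>\<Gamma>'\<^esub>"])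
next
  case False
  let ?\<theta>' = "inv_into (carrier dom.QV) \<theta>"
  interpret N: QV_iso_nontrivial \<Gamma> \<alpha> \<Gamma>' \<alpha>' \<theta> using False by unfold_locales auto
  interpret J: QV_iso \<Gamma>' \<alpha>' \<Gamma> \<alpha> ?\<theta>' by (rule inverse_iso)
  interpret I: QV_iso_nontrivial \<Gamma>' \<alpha>' \<Gamma> \<alpha> ?\<theta>'
    using J.trivial_imp_trivial False by unfold_locales blast
  have inv1: "J.phi (phi v) = v" if "v \<in> thompsonV" for v
    by (rule phi_inverse [OF inverse_iso theta_left_inverse that])
  have inv2: "phi (J.phi v) = v" if "v \<in> thompsonV" for v
    by (rule J.phi_inverse [OF QV_iso_axioms theta_right_inverse that])
  define \<sigma> where "\<sigma> = I.pt"
  have sQ: "\<sigma> x \<in> Q2" if "x \<in> Q2" for x using I.pt_Q2 that by (simp add: \<sigma>_def)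
  have equiv: "phi v (\<sigma> x) = \<sigma> (v x)" if "v \<in> thompsonV" "x \<in> Q2" for v x
    using I.pt_equivariant [OF phi_thompsonV [OF that(1)] that(2)] inv1 [OF that(1)]
    by (simp add: \<sigma>_def)
  have equiv': "J.phi u (N.pt z) = N.pt (u z)" if "u \<in> thompsonV" "z \<in> Q2" for u z
    using N.pt_equivariant [OF J.phi_thompsonV [OF that(1)] that(2)] inv2 [OF that(1)] by simp
  \<comment> \<open>Both composites of the point maps commute with \<open>V\<close>, hence are the
    identity on \<open>Q2\<close>.\<close>
  have ps: "N.pt (\<sigma> x) = x" if x: "x \<in> Q2" for x
  proof -
    have "(N.pt \<circ> \<sigma>) x = x"
    proof (rule thompsonV_equivariant_id)
      fix v x assume "v \<in> thompsonV" "x \<in> Q2"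
      then show "(N.pt \<circ> \<sigma>) (v x) = v ((N.pt \<circ> \<sigma>) x)"
        using N.pt_equivariant [of v "\<sigma> x"] sQ equiv by simp
    qed (use x sQ N.pt_Q2 in auto)
    then show ?thesis by simp
  qed
  have sp: "\<sigma> (N.pt z) = z" if z: "z \<in> Q2" for z
  proof -
    have "(\<sigma> \<circ> N.pt) z = z"
    proof (rule thompsonV_equivariant_id)
      fix u z assume u: "u \<in> thompsonV" "z \<in> Q2"
      show "(\<sigma> \<circ> N.pt) (u z) = u ((\<sigma> \<circ> N.pt) z)"
        using equiv' [OF u] equiv [OF J.phi_thompsonV [OF u(1)] N.pt_Q2 [OF u(2)]] inv2 [OF u(1)]
        by simp
    qed (use z sQ N.pt_Q2 in auto)
    then show ?thesis by simp
  qed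
  have inj: "inj_on \<sigma> Q2" "inj_on N.pt Q2" using ps sp by (metis inj_onI)+
  \<comment> \<open>The sign of the logarithmic slope is controlled for \<open>phi\<close> and for
    its inverse, so slope one at fixed points is preserved both ways.\<close>
  have le: "log_slope (phi v) (\<sigma> x) \<le> 0"
    if "v \<in> thompsonV" "x \<in> Q2" "v x = x" "log_slope v x \<le> 0" for v x
    by (rule spatial_nonexpanding [where \<phi> = phi and \<sigma> = \<sigma>])
      (assumption | rule phi_thompsonV phi_surj phi_vinv sQ inj(1) equiv that)+
  have ge: "0 \<le> log_slope (phi v) (\<sigma> x)"
    if "v \<in> thompsonV" "x \<in> Q2" "v x = x" "0 \<le> log_slope v x" for v x
    by (rule spatial_nonexpanding_vinv [where \<phi> = phi and \<sigma> = \<sigma>])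
      (assumption | rule phi_thompsonV phi_surj phi_vinv sQ inj(1) equiv that)+
  have le': "log_slope (J.phi v) (N.pt x) \<le> 0"
    if "v \<in> thompsonV" "x \<in> Q2" "v x = x" "log_slope v x \<le> 0" for v x
    by (rule spatial_nonexpanding [where \<phi> = J.phi and \<sigma> = N.pt])
      (assumption | rule J.phi_thompsonV J.phi_surj J.phi_vinv N.pt_Q2 inj(2) equiv' that)+
  have ge': "0 \<le> log_slope (J.phi v) (N.pt x)"
    if "v \<in> thompsonV" "x \<in> Q2" "v x = x" "0 \<le> log_slope v x" for v x
    by (rule spatial_nonexpanding_vinv [where \<phi> = J.phi and \<sigma> = N.pt])
      (assumption | rule J.phi_thompsonV J.phi_surj J.phi_vinv N.pt_Q2 inj(2) equiv' that)+
  obtain x where x: "x \<in> Q2" using exists_fresh_Q2 [of "{}"] by auto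
  define y where "y = \<sigma> x"
  have y: "y \<in> Q2" and py: "N.pt y = x" using sQ x ps by (auto simp: y_def)
  have fx: "phi v y = y" if "v \<in> thompsonV" "v x = x" for v
    using equiv [OF that(1) x] that(2) by (simp add: y_def)
  have fx': "J.phi u x = x" if "u \<in> thompsonV" "u y = y" for u
    using equiv' [OF that(1) y] that(2) py by simp
  \<comment> \<open>This and its mirror image are what \<open>theta_single\<close> requires to match
    the summands at \<open>x\<close> and \<open>y\<close>.\<close>
  have stab: "\<exists>e\<in>tangent_stab x. phi e = w" if w: "w \<in> tangent_stab y" for w
  proof -
    have wV: "w \<in> thompsonV" "w y = y" "log_slope w y = 0" using w by (auto simp: tangent_stab_def)
    have "log_slope (J.phi w) x = 0"
      using le' [OF wV(1) y wV(2)] ge' [OF wV(1) y wV(2)] wV(3) py by simp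
    then have "J.phi w \<in> tangent_stab x"
      using fx' [OF wV(1,2)] J.phi_thompsonV [OF wV(1)] by (simp add: tangent_stab_def)
    then show ?thesis using inv2 [OF wV(1)] by blast
  qed
  have stab': "\<exists>e\<in>tangent_stab y. J.phi e = w" if w: "w \<in> tangent_stab x" for w
  proof -
    have wV: "w \<in> thompsonV" "w x = x" "log_slope w x = 0" using w by (auto simp: tangent_stab_def)
    have "log_slope (phi w) y = 0"
      using le [OF wV(1) x wV(2)] ge [OF wV(1) x wV(2)] wV(3) by (simp add: y_def)
    then have "phi w \<in> tangent_stab y"
      using fx [OF wV(1,2)] phi_thompsonV [OF wV(1)] by (simp add: tangent_stab_def)
    then show ?thesis using inv1 [OF wV(1)] by blast
  qed
  define \<beta> where "\<beta> g = fst (\<theta> (dom.single x g, id)) y" for g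
  have beta: "\<beta> g \<in> carrier \<Gamma>'" "\<theta> (dom.single x g, id) = (cod.single y (\<beta> g), id)"
    if g: "g \<in> carrier \<Gamma>" for g
  proof -
    obtain g' where "g' \<in> carrier \<Gamma>'" "\<theta> (dom.single x g, id) = (cod.single y g', id)"
      using theta_single [OF x y g stab] by blast
    then show "\<beta> g \<in> carrier \<Gamma>'" "\<theta> (dom.single x g, id) = (cod.single y (\<beta> g), id)"
      by (simp_all add: \<beta>_def cod.single_def)
  qed
  have single_inj: "g = h" if "dom.single z g = dom.single z h" for z g h
    using fun_cong [OF that, of z] by (simp add: dom.single_def)
  have single_inj': "g = h" if "cod.single z g = cod.single z h" for z g h
    using fun_cong [OF that, of z] by (simp add: cod.single_def)
  have beta_mult: "\<beta> (g \<otimes>\<^bsub>\<Gamma>\<^esub> h) = \<beta> g \<otimes>\<^bsub>\<Gamma>'\<^esub> \<beta> h" if "g \<in> carrier \<Gamma>" "h \<in> carrier \<Gamma>" for g h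
  proof -
    have "(cod.single y (\<beta> (g \<otimes>\<^bsub>\<Gamma>\<^esub> h)), id) = \<theta> ((dom.single x g, id) \<otimes>\<^bsub>dom.QV\<^esub> (dom.single x h, id))"
      using that beta by (simp add: dom.single_mult)
    also have "\<dots> = (cod.single y (\<beta> g \<otimes>\<^bsub>\<Gamma>'\<^esub> \<beta> h), id)"
      using that beta x theta_mult [of "(dom.single x g, id)" "(dom.single x h, id)"]
      by (simp add: cod.single_mult)
    finally show ?thesis by (simp add: single_inj')
  qed
  have "inj_on \<beta> (carrier \<Gamma>)"
  proof (rule inj_onI)
    fix g h assume gh: "g \<in> carrier \<Gamma>" "h \<in> carrier \<Gamma>" "\<beta> g = \<beta> h"
    then have "\<theta> (dom.single x g, id) = \<theta> (dom.single x h, id)" using beta by simp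
    from inj_onD [OF bij_betw_imp_inj_on [OF theta_bij] this dom.single_QV [OF x gh(1)]
        dom.single_QV [OF x gh(2)]]
    have "dom.single x g = dom.single x h" by simp
    then show "g = h" by (rule single_inj)
  qed
  moreover have "\<beta> ` carrier \<Gamma> = carrier \<Gamma>'"
  proof
    show "\<beta> ` carrier \<Gamma> \<subseteq> carrier \<Gamma>'" using beta by blast
    show "carrier \<Gamma>' \<subseteq> \<beta> ` carrier \<Gamma>"
    proof
      fix g' assume g': "g' \<in> carrier \<Gamma>'"
      obtain g where g: "g \<in> carrier \<Gamma>" "?\<theta>' (cod.single y g', id) = (dom.single x g, id)"
        using J.theta_single [OF y x g' stab'] by blast
      have "\<theta> (dom.single x g, id) = (cod.single y g', id)"
        using theta_right_inverse [OF cod.single_QV [OF y g']] g(2) by simp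
      then have "g' = \<beta> g" using beta(2) [OF g(1)] by (intro single_inj' [of y]) simp
      then show "g' \<in> \<beta> ` carrier \<Gamma>" using g(1) by blast
    qed
  qed
  ultimately have bij: "bij_betw \<beta> (carrier \<Gamma>) (carrier \<Gamma>')" by (simp add: bij_betw_def)
  then have "\<beta> \<in> iso \<Gamma> \<Gamma>'" using beta beta_mult by (auto simp: iso_def hom_def)
  obtain v where v: "v \<in> thompsonV" "v x = x" "log_slope v x = 1" using exists_slope_two [OF x] by blast
  \<comment> \<open>Positivity is preserved, so the value is at least one. For the upper bound, an
    \<open>e\<close> of slope two at \<open>y\<close> is pulled back to \<open>w\<close>, whose
    logarithmic slope at \<open>x\<close> is at least that of \<open>v\<close>; the image of
    \<open>vinv v \<circ> w\<close> then has nonnegative logarithmic slope at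
    \<open>y\<close>.\<close>
  have slope: "log_slope (phi v) y = 1"
  proof -
    obtain e where e: "e \<in> thompsonV" "e y = y" "log_slope e y = 1" using exists_slope_two [OF y] by blast
    define w where "w = J.phi e"
    have w: "w \<in> thompsonV" "w x = x" "phi w = e"
      using J.phi_thompsonV [OF e(1)] fx' [OF e(1,2)] inv2 [OF e(1)] by (auto simp: w_def)
    have "\<not> log_slope w x \<le> 0"
      using le [OF w(1) x w(2)] e(3) w(3) by (auto simp: y_def)
    moreover have comp: "log_slope (vinv v \<circ> w) x = log_slope w x - 1"
      using log_slope_comp [OF thompsonV_vinv [OF v(1)] w(1), of x] log_slope_vinv [OF v(1), of x] v w
      by simp
    moreover have "vinv v \<circ> w \<in> thompsonV" "(vinv v \<circ> w) x = x"
      using v w thompsonV_vinv_apply [OF v(1), of x] by (simp_all add: thompsonV_comp thompsonV_vinv)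
    ultimately have "0 \<le> log_slope (phi (vinv v \<circ> w)) y"
      using ge [of "vinv v \<circ> w" x] x by (simp add: y_def)
    moreover have "log_slope (phi (vinv v \<circ> w)) y = 1 - log_slope (phi v) y"
      using log_slope_comp [OF thompsonV_vinv [OF phi_thompsonV [OF v(1)]] e(1), of y]
        log_slope_vinv [OF phi_thompsonV [OF v(1)], of y] fx [OF v(1,2)] e w(3)
        phi_comp [OF thompsonV_vinv [OF v(1)] w(1)] phi_vinv [OF v(1)]
      by simp
    moreover have "\<not> log_slope (phi v) y \<le> 0"
      using le' [OF phi_thompsonV [OF v(1)] y fx [OF v(1,2)]] inv1 [OF v(1)] py v(3) by auto
    ultimately show ?thesis by linarith
  qed
  obtain c where c: "c \<in> fin_supp \<Gamma>'" "\<theta> (\<lambda>_. \<one>\<^bsub>\<Gamma>\<^esub>, v) = (c, phi v)" by (rule theta_V [OF v(1)])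
  \<comment> \<open>Conjugation by \<open>v\<close> acts as \<alpha> on the summand at
    \<open>x\<close>. Its image under \<theta> acts as \<alpha>' on the summand at \<open>y\<close>,
    up to the inner automorphism given by \<open>c y\<close>.\<close>
  have key: "\<beta> (\<alpha> g) = c y \<otimes>\<^bsub>\<Gamma>'\<^esub> \<alpha>' (\<beta> g) \<otimes>\<^bsub>\<Gamma>'\<^esub> inv\<^bsub>\<Gamma>'\<^esub> c y" if g: "g \<in> carrier \<Gamma>" for g
  proof -
    let ?r = "c y \<otimes>\<^bsub>\<Gamma>'\<^esub> \<alpha>' (\<beta> g) \<otimes>\<^bsub>\<Gamma>'\<^esub> inv\<^bsub>\<Gamma>'\<^esub> c y"
    have ag: "\<alpha> g \<in> carrier \<Gamma>" using dom.ap_closed [OF g, of 1] by simp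
    have ag': "\<alpha>' (\<beta> g) \<in> carrier \<Gamma>'" using cod.ap_closed [OF beta(1) [OF g], of 1] by simp
    have "(\<lambda>_. \<one>\<^bsub>\<Gamma>\<^esub>, v) \<otimes>\<^bsub>dom.QV\<^esub> (dom.single x g, id) = (dom.single x (\<alpha> g), id) \<otimes>\<^bsub>dom.QV\<^esub> (\<lambda>_. \<one>\<^bsub>\<Gamma>\<^esub>, v)"
      using dom.conj_single [of "\<lambda>_. \<one>\<^bsub>\<Gamma>\<^esub>" v g x] v g ag by simp
    then have "(c, phi v) \<otimes>\<^bsub>cod.QV\<^esub> (cod.single y (\<beta> g), id) = (cod.single y (\<beta> (\<alpha> g)), id) \<otimes>\<^bsub>cod.QV\<^esub> (c, phi v)"
      using theta_mult [OF V_in_QV [OF v(1)] dom.single_QV [OF x g]]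
        theta_mult [OF dom.single_QV [OF x ag] V_in_QV [OF v(1)]] c(2) beta(2) [OF g] beta(2) [OF ag]
      by simp
    then have "(cod.single y ?r, id) \<otimes>\<^bsub>cod.QV\<^esub> (c, phi v) = (cod.single y (\<beta> (\<alpha> g)), id) \<otimes>\<^bsub>cod.QV\<^esub> (c, phi v)"
      using cod.conj_single [OF c(1) phi_thompsonV [OF v(1)] beta(1) [OF g], of y] fx [OF v(1,2)] slope
      by simp
    moreover have "(c, phi v) \<in> carrier cod.QV" using c(1) phi_thompsonV [OF v(1)] by (simp add: cod.QV_carrier)
    moreover have "?r \<in> carrier \<Gamma>'" using c(1) ag' by simp
    ultimately have "cod.single y ?r = cod.single y (\<beta> (\<alpha> g))"
      using group.right_cancel [OF cod.QV_group] cod.single_QV [OF y] beta(1) [OF ag] by (metis prod.inject)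
    then show ?thesis using single_inj' by metis
  qed
  show ?thesis
  \<comment> \<open>Solving \<open>key\<close> for \<alpha>' turns \<open>c y\<close> into its
    inverse, the required \<open>h\<close>.\<close>
  proof (intro bexI [of _ \<beta>] bexI [of _ "inv\<^bsub>\<Gamma>'\<^esub> c y"] ballI)
    fix g' assume g': "g' \<in> carrier \<Gamma>'"
    define g where "g = inv_into (carrier \<Gamma>) \<beta> g'"
    have g: "g \<in> carrier \<Gamma>" "\<beta> g = g'"
      using bij g' unfolding g_def by (simp_all add: bij_betw_def inv_into_into f_inv_into_f)
    have "\<alpha>' g' \<in> carrier \<Gamma>'" using cod.ap_closed [OF g', of 1] by simp
    then show "\<alpha>' g' = inv\<^bsub>\<Gamma>'\<^esub> c y \<otimes>\<^bsub>\<Gamma>'\<^esub> \<beta> (\<alpha> (inv_into (carrier \<Gamma>) \<beta> g')) \<otimes>\<^bsub>\<Gamma>'\<^esub> inv\<^bsub>\<Gamma>'\<^esub> (inv\<^bsub>\<Gamma>'\<^esub> c y)"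
      using key [OF g(1)] g(2) c(1) cod.inv_solve_left cod.m_assoc
      unfolding g_def [symmetric] by (simp add: cod.m_assoc flip: cod.m_assoc [of "inv\<^bsub>\<Gamma>'\<^esub> c y" "c y"])
  qed (use c(1) \<open>\<beta> \<in> iso \<Gamma> \<Gamma>'\<close> in auto)
qed

section \<open>From conjugate automorphisms to isomorphic groups\<close>

text \<open>The value at the zero sequence is unspecified; this affects only finitely many points below.\<close>

definition last_one :: "cantor \<Rightarrow> int" where
  "last_one x = int (Max {n. x n})"

lemma last_one_concat_word:
  assumes "y \<in> Q2" "y \<noteq> (\<lambda>_. False)"
  shows "last_one (m @@ y) = int (length m) + last_one y"
proof -
  let ?S = "{n. y n}"
  have fin: "finite ?S" using assms(1) by (simp add: Q2_def)
  have ne: "?S \<noteq> {}" using assms(2) by auto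
  have "Max {n. (m @@ y) n} = length m + Max ?S"
  proof (rule Max_eqI)
    show "finite {n. (m @@ y) n}"
      using concat_word_Q2_iff [of m y] assms(1) by (simp add: Q2_def)
    show "length m + Max ?S \<in> {n. (m @@ y) n}"
      using Max_in [OF fin ne] by (simp add: concat_word_add)
    fix n assume n: "n \<in> {n. (m @@ y) n}"
    show "n \<le> length m + Max ?S"
    proof (cases "n < length m")
      case False
      then have "y (n - length m)" using n by (simp add: concat_word_def)
      then show ?thesis using Max_ge [OF fin, of "n - length m"] by simp
    qed simp
  qed
  then show ?thesis by (simp add: last_one_def)
qed

text \<open>Off a finite set the slope cocycle is a coboundary.\<close>

lemma finite_last_one_defect:
  assumes "v \<in> thompsonV"
  shows "finite {x \<in> Q2. log_slope v x \<noteq> last_one x - last_one (v x)}"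
proof -
  obtain N where N: "\<And>m. length m = N \<Longrightarrow> \<exists>m'. acts_by v m m'"
    using assms unfolding thompsonV_iff by blast
  \<comment> \<open>If the tail after \<open>N\<close> letters is nonzero, it contains the last
    digit \<open>1\<close>, which shifts with the word lengths, so equality holds. Only the points
    with zero tail remain.\<close>
  have "{x \<in> Q2. log_slope v x \<noteq> last_one x - last_one (v x)}
      \<subseteq> (\<lambda>m. m @@ (\<lambda>_. False)) ` {m. length m = N}"
  proof
    fix x assume "x \<in> {x \<in> Q2. log_slope v x \<noteq> last_one x - last_one (v x)}"
    then have x: "x \<in> Q2" "log_slope v x \<noteq> last_one x - last_one (v x)" by auto
    let ?m = "prefix_word N x"
    obtain y where y: "x = ?m @@ y" using in_cyl_prefix_word [of x N] by (auto simp: cyl_def)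
    obtain m' where m': "acts_by v ?m m'" using N by force
    have yQ: "y \<in> Q2" using x(1) y concat_word_Q2_iff by metis
    have "v x = m' @@ y" using m' y by (metis acts_by_def)
    moreover have "log_slope v x = int N - int (length m')"
      using log_slope_eq [OF m', of y] y by simp
    ultimately have "y = (\<lambda>_. False)"
      using x(2) last_one_concat_word [OF yQ, of ?m] last_one_concat_word [OF yQ, of m'] y by force
    then show "x \<in> (\<lambda>m. m @@ (\<lambda>_. False)) ` {m. length m = N}"
      using y by (intro image_eqI [of _ _ ?m]) auto
  qed
  then show ?thesis using finite_words finite_subset by blast
qed

section \<open>The cocycle that compares the two automorphisms\<close>

locale outer_conjugate_pair = dom: twisted_group \<Gamma> \<alpha> + cod: twisted_group \<Gamma>' \<alpha>'
  for \<Gamma> :: "('a, 'm) monoid_scheme" and \<alpha> and \<Gamma>' :: "('b, 'n) monoid_scheme" and \<alpha>' +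
  fixes \<beta> and h
  assumes beta_iso: "\<beta> \<in> iso \<Gamma> \<Gamma>'" and h_closed [simp]: "h \<in> carrier \<Gamma>'"
    and conj: "\<And>g. g \<in> carrier \<Gamma> \<Longrightarrow> \<alpha>' (\<beta> g) = h \<otimes>\<^bsub>\<Gamma>'\<^esub> \<beta> (\<alpha> g) \<otimes>\<^bsub>\<Gamma>'\<^esub> inv\<^bsub>\<Gamma>'\<^esub> h"
begin

text \<open>An affine bijection rather than an automorphism: by \<open>T_pow\<close> its powers are
  \<open>k n\<close> times the powers of \<alpha>', so negative exponents come for free.\<close>

definition T :: "'b \<Rightarrow> 'b" where
  "T g = inv\<^bsub>\<Gamma>'\<^esub> h \<otimes>\<^bsub>\<Gamma>'\<^esub> \<alpha>' g"

text \<open>The orbit of the identity under \<open>T\<close> is a cocycle of the integers comparing the powers of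
  \<open>\<alpha>'\<close> with those of \<open>\<beta> \<circ> \<alpha> \<circ> \<beta>\<inverse>\<close>.\<close>

definition k :: "int \<Rightarrow> 'b" where
  "k n = aut_pow \<Gamma>' T n \<one>\<^bsub>\<Gamma>'\<^esub>"

lemma aut_closed [simp]: "g \<in> carrier \<Gamma> \<Longrightarrow> \<alpha> g \<in> carrier \<Gamma>"
  using dom.ap_closed [of g 1] by simp

lemma aut_closed' [simp]: "g \<in> carrier \<Gamma>' \<Longrightarrow> \<alpha>' g \<in> carrier \<Gamma>'"
  using cod.ap_closed [of g 1] by simp

lemma beta_bij: "bij_betw \<beta> (carrier \<Gamma>) (carrier \<Gamma>')"
  using beta_iso by (simp add: iso_def)

lemma beta_closed [simp]: "g \<in> carrier \<Gamma> \<Longrightarrow> \<beta> g \<in> carrier \<Gamma>'"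
  using beta_bij bij_betwE by blast

lemma beta_mult: "g \<in> carrier \<Gamma> \<Longrightarrow> g' \<in> carrier \<Gamma> \<Longrightarrow> \<beta> (g \<otimes>\<^bsub>\<Gamma>\<^esub> g') = \<beta> g \<otimes>\<^bsub>\<Gamma>'\<^esub> \<beta> g'"
  using beta_iso by (simp add: iso_def hom_mult)

lemma beta_eq_iff: "g \<in> carrier \<Gamma> \<Longrightarrow> g' \<in> carrier \<Gamma> \<Longrightarrow> \<beta> g = \<beta> g' \<longleftrightarrow> g = g'"
  using bij_betw_imp_inj_on [OF beta_bij] by (rule inj_on_eq_iff)

lemma beta_one: "\<beta> \<one>\<^bsub>\<Gamma>\<^esub> = \<one>\<^bsub>\<Gamma>'\<^esub>"
  using beta_mult [of "\<one>\<^bsub>\<Gamma>\<^esub>" "\<one>\<^bsub>\<Gamma>\<^esub>"] by simp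

lemma T_bij: "bij_betw T (carrier \<Gamma>') (carrier \<Gamma>')"
proof -
  have "bij_betw (\<lambda>g. inv\<^bsub>\<Gamma>'\<^esub> h \<otimes>\<^bsub>\<Gamma>'\<^esub> g) (carrier \<Gamma>') (carrier \<Gamma>')"
    by (rule bij_betw_byWitness [where f' = "\<lambda>g. h \<otimes>\<^bsub>\<Gamma>'\<^esub> g"])
      (auto simp flip: cod.m_assoc)
  from bij_betw_trans [OF cod.aut_bij this] show ?thesis
    by (simp add: T_def [abs_def] comp_def)
qed

lemma T_eq_iff: "g \<in> carrier \<Gamma>' \<Longrightarrow> g' \<in> carrier \<Gamma>' \<Longrightarrow> T g = T g' \<longleftrightarrow> g = g'"
  using bij_betw_imp_inj_on [OF T_bij] by (rule inj_on_eq_iff)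

lemma k_closed [simp]: "k n \<in> carrier \<Gamma>'"
  unfolding k_def by (rule aut_pow_closed [OF T_bij]) simp

lemma T_pow_closed: "g \<in> carrier \<Gamma>' \<Longrightarrow> aut_pow \<Gamma>' T n g \<in> carrier \<Gamma>'"
  by (rule aut_pow_closed [OF T_bij])

lemma k_Suc: "k (n + 1) = T (k n)"
  unfolding k_def by (rule aut_pow_Suc [OF T_bij]) simp

lemma k_0: "k 0 = \<one>\<^bsub>\<Gamma>'\<^esub>"
  by (simp add: k_def)

lemma T_pow:
  assumes g: "g \<in> carrier \<Gamma>'"
  shows "aut_pow \<Gamma>' T n g = k n \<otimes>\<^bsub>\<Gamma>'\<^esub> cod.ap n g"
proof (induction n rule: int_shift_induct)
  fix n
  have "k (n + 1) \<otimes>\<^bsub>\<Gamma>'\<^esub> cod.ap (n + 1) g = T (k n \<otimes>\<^bsub>\<Gamma>'\<^esub> cod.ap n g)"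
    using g by (simp add: k_Suc aut_pow_Suc [OF cod.aut_bij] T_def cod.aut_mult cod.m_assoc)
  then show "aut_pow \<Gamma>' T n g = k n \<otimes>\<^bsub>\<Gamma>'\<^esub> cod.ap n g \<longleftrightarrow>
      aut_pow \<Gamma>' T (n + 1) g = k (n + 1) \<otimes>\<^bsub>\<Gamma>'\<^esub> cod.ap (n + 1) g"
    using g T_pow_closed by (simp add: aut_pow_Suc [OF T_bij] T_eq_iff)
qed (use g k_0 in simp)

text \<open>The cocycle law is the power \<open>n + m\<close> of \<open>T\<close>, evaluated at the
  identity in two ways.\<close>

lemma k_add: "k (n + m) = k n \<otimes>\<^bsub>\<Gamma>'\<^esub> cod.ap n (k m)"
  using T_pow [OF k_closed [of m], of n] aut_pow_add [OF T_bij, of "\<one>\<^bsub>\<Gamma>'\<^esub>" n m] by (simp add: k_def)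

text \<open>Each application of \<open>T\<close> multiplies by the inverse of \<open>h\<close>,
  which cancels the \<open>h\<close> produced by \<open>conj\<close>.\<close>

lemma k_beta:
  assumes g: "g \<in> carrier \<Gamma>"
  shows "k n \<otimes>\<^bsub>\<Gamma>'\<^esub> cod.ap n (\<beta> g) = \<beta> (dom.ap n g) \<otimes>\<^bsub>\<Gamma>'\<^esub> k n"
proof -
  have "aut_pow \<Gamma>' T n (\<beta> g) = \<beta> (dom.ap n g) \<otimes>\<^bsub>\<Gamma>'\<^esub> k n"
  proof (induction n rule: int_shift_induct)
    fix n
    have "T (\<beta> (dom.ap n g) \<otimes>\<^bsub>\<Gamma>'\<^esub> k n) =
        inv\<^bsub>\<Gamma>'\<^esub> h \<otimes>\<^bsub>\<Gamma>'\<^esub> (h \<otimes>\<^bsub>\<Gamma>'\<^esub> (\<beta> (dom.ap (n + 1) g) \<otimes>\<^bsub>\<Gamma>'\<^esub> T (k n)))"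
      using g by (simp add: T_def cod.aut_mult conj aut_pow_Suc [OF dom.aut_bij] cod.m_assoc)
    also have "\<dots> = \<beta> (dom.ap (n + 1) g) \<otimes>\<^bsub>\<Gamma>'\<^esub> k (n + 1)"
      using g k_closed [of "n + 1"] by (simp add: k_Suc flip: cod.m_assoc)
    finally show "aut_pow \<Gamma>' T n (\<beta> g) = \<beta> (dom.ap n g) \<otimes>\<^bsub>\<Gamma>'\<^esub> k n \<longleftrightarrow>
        aut_pow \<Gamma>' T (n + 1) (\<beta> g) = \<beta> (dom.ap (n + 1) g) \<otimes>\<^bsub>\<Gamma>'\<^esub> k (n + 1)"
      using g T_pow_closed by (simp add: aut_pow_Suc [OF T_bij] T_eq_iff flip: T_eq_iff)
  qed (use g k_0 in simp)
  then show ?thesis using T_pow g by simp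
qed

section \<open>The twisted isomorphism\<close>

definition shift :: "(cantor \<Rightarrow> cantor) \<Rightarrow> cantor \<Rightarrow> int" where
  "shift v x = log_slope v (vinv v x) - last_one (vinv v x)"

lemma shift_apply: "v \<in> thompsonV \<Longrightarrow> shift v (v y) = log_slope v y - last_one y"
  by (simp add: shift_def)

lemma finite_shift_defect:
  assumes "v \<in> thompsonV"
  shows "finite {x \<in> Q2. shift v x \<noteq> - last_one x}"
proof -
  have "{x \<in> Q2. shift v x \<noteq> - last_one x} \<subseteq> v ` {x \<in> Q2. log_slope v x \<noteq> last_one x - last_one (v x)}"
  proof
    fix x assume "x \<in> {x \<in> Q2. shift v x \<noteq> - last_one x}"
    then show "x \<in> v ` {x \<in> Q2. log_slope v x \<noteq> last_one x - last_one (v x)}"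
      using assms by (intro image_eqI [of _ _ "vinv v x"]) (simp_all add: shift_def)
  qed
  then show ?thesis using finite_last_one_defect [OF assms] finite_subset by blast
qed

text \<open>The direct candidate multiplies the \<beta>-image of the value by \<open>k\<close> of
  the logarithmic slope, which may destroy finite support. It is conjugated by the function
  \<open>k (- last_one x)\<close>, not finitely supported in general; the cocycle law merges the
  factors on the right into \<open>k (shift v x)\<close>.\<close>

definition twist :: "(cantor \<Rightarrow> 'a) \<times> (cantor \<Rightarrow> cantor) \<Rightarrow> (cantor \<Rightarrow> 'b) \<times> (cantor \<Rightarrow> cantor)" where
  "twist p = (\<lambda>x. if x \<in> Q2
      then inv\<^bsub>\<Gamma>'\<^esub> k (- last_one x) \<otimes>\<^bsub>\<Gamma>'\<^esub> \<beta> (fst p x) \<otimes>\<^bsub>\<Gamma>'\<^esub> k (shift (snd p) x) else \<one>\<^bsub>\<Gamma>'\<^esub>, snd p)"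

text \<open>Off the support of \<open>a\<close> and the finite defect set, the two factors
  \<open>k\<close> cancel.\<close>

lemma twist_closed:
  assumes "p \<in> carrier dom.QV"
  shows "twist p \<in> carrier cod.QV"
proof -
  obtain a v where p: "p = (a, v)" "a \<in> fin_supp \<Gamma>" "v \<in> thompsonV"
    using assms by (auto simp: dom.QV_carrier)
  have "fst (twist p) \<in> fin_supp \<Gamma>'"
  proof (rule cod.fin_suppI)
    have "{x. fst (twist p) x \<noteq> \<one>\<^bsub>\<Gamma>'\<^esub>} \<subseteq> {x. a x \<noteq> \<one>\<^bsub>\<Gamma>\<^esub>} \<union> {x \<in> Q2. shift v x \<noteq> - last_one x}"
      by (auto simp: twist_def p(1) beta_one split: if_splits)
    then show "finite {x. fst (twist p) x \<noteq> \<one>\<^bsub>\<Gamma>'\<^esub>}"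
      by (rule finite_subset) (use dom.fin_supp_finite [OF p(2)] finite_shift_defect [OF p(3)] in blast)
  qed (use p in \<open>auto simp: twist_def\<close>)
  then show ?thesis using p by (simp add: cod.QV_carrier twist_def)
qed

text \<open>Multiplicativity of \<open>twist\<close> at one point. Expanding
  \<open>k (n + l)\<close> by the cocycle law cancels \<open>k l\<close> inside the power of
  \<alpha>', and \<open>k_beta\<close> then moves \<open>k n\<close> past the \<beta>-image.\<close>

lemma cocycle_identity:
  assumes A: "A \<in> carrier \<Gamma>'" and g: "g \<in> carrier \<Gamma>" and g': "g' \<in> carrier \<Gamma>"
  shows "(A \<otimes>\<^bsub>\<Gamma>'\<^esub> \<beta> g \<otimes>\<^bsub>\<Gamma>'\<^esub> k (n + l)) \<otimes>\<^bsub>\<Gamma>'\<^esub> cod.ap n (inv\<^bsub>\<Gamma>'\<^esub> k l \<otimes>\<^bsub>\<Gamma>'\<^esub> \<beta> g' \<otimes>\<^bsub>\<Gamma>'\<^esub> k m) =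
    A \<otimes>\<^bsub>\<Gamma>'\<^esub> \<beta> (g \<otimes>\<^bsub>\<Gamma>\<^esub> dom.ap n g') \<otimes>\<^bsub>\<Gamma>'\<^esub> k (n + m)"
proof -
  have "cod.ap n (k l) \<otimes>\<^bsub>\<Gamma>'\<^esub> cod.ap n (inv\<^bsub>\<Gamma>'\<^esub> k l \<otimes>\<^bsub>\<Gamma>'\<^esub> \<beta> g' \<otimes>\<^bsub>\<Gamma>'\<^esub> k m)
      = cod.ap n (k l \<otimes>\<^bsub>\<Gamma>'\<^esub> (inv\<^bsub>\<Gamma>'\<^esub> k l \<otimes>\<^bsub>\<Gamma>'\<^esub> (\<beta> g' \<otimes>\<^bsub>\<Gamma>'\<^esub> k m)))"
    using g' by (simp add: cod.ap_mult cod.m_assoc)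
  also have "\<dots> = cod.ap n (\<beta> g') \<otimes>\<^bsub>\<Gamma>'\<^esub> cod.ap n (k m)"
    using g' by (simp add: cod.ap_mult flip: cod.m_assoc)
  finally have 1: "cod.ap n (k l) \<otimes>\<^bsub>\<Gamma>'\<^esub> cod.ap n (inv\<^bsub>\<Gamma>'\<^esub> k l \<otimes>\<^bsub>\<Gamma>'\<^esub> \<beta> g' \<otimes>\<^bsub>\<Gamma>'\<^esub> k m)
      = cod.ap n (\<beta> g') \<otimes>\<^bsub>\<Gamma>'\<^esub> cod.ap n (k m)" .
  have "k (n + l) \<otimes>\<^bsub>\<Gamma>'\<^esub> cod.ap n (inv\<^bsub>\<Gamma>'\<^esub> k l \<otimes>\<^bsub>\<Gamma>'\<^esub> \<beta> g' \<otimes>\<^bsub>\<Gamma>'\<^esub> k m)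
      = (k n \<otimes>\<^bsub>\<Gamma>'\<^esub> cod.ap n (\<beta> g')) \<otimes>\<^bsub>\<Gamma>'\<^esub> cod.ap n (k m)"
    using g' 1 by (simp add: k_add cod.m_assoc)
  also have "\<dots> = \<beta> (dom.ap n g') \<otimes>\<^bsub>\<Gamma>'\<^esub> k (n + m)"
    using g' by (simp add: k_beta k_add cod.m_assoc)
  finally show ?thesis using A g g' by (simp add: beta_mult cod.m_assoc)
qed

lemma twist_mult:
  assumes "p \<in> carrier dom.QV" "q \<in> carrier dom.QV"
  shows "twist (p \<otimes>\<^bsub>dom.QV\<^esub> q) = twist p \<otimes>\<^bsub>cod.QV\<^esub> twist q"
proof -
  obtain a v where p: "p = (a, v)" "a \<in> fin_supp \<Gamma>" "v \<in> thompsonV"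
    using assms by (auto simp: dom.QV_carrier)
  obtain b w where q: "q = (b, w)" "b \<in> fin_supp \<Gamma>" "w \<in> thompsonV"
    using assms by (auto simp: dom.QV_carrier)
  obtain b' where b': "twist q = (b', w)" by (simp add: q twist_def)
  have "fst (twist (p \<otimes>\<^bsub>dom.QV\<^esub> q)) x = fst (twist p) x \<otimes>\<^bsub>\<Gamma>'\<^esub> cod.act v b' x" for x
  proof (cases "x \<in> Q2")
    case True
    define y where "y = vinv v x"
    define z where "z = vinv w y"
    have x: "x = v y" and y: "y = w z" using p q by (simp_all add: y_def z_def)
    have yQ: "y \<in> Q2" using True p by (simp add: y_def)
    have b'y: "b' y = inv\<^bsub>\<Gamma>'\<^esub> k (- last_one y) \<otimes>\<^bsub>\<Gamma>'\<^esub> \<beta> (b y) \<otimes>\<^bsub>\<Gamma>'\<^esub> k (shift w y)"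
      using b' yQ by (auto simp: twist_def q)
    \<comment> \<open>The chain rule matches the exponents with those of
      \<open>cocycle_identity\<close>.\<close>
    have "shift (v \<circ> w) x = log_slope v y + shift w y"
      using shift_apply [OF thompsonV_comp [OF p(3) q(3)], of z] log_slope_comp [OF p(3) q(3), of z]
        shift_apply [OF q(3), of z] x y by simp
    moreover have "shift v x = log_slope v y + - last_one y"
      using shift_apply [OF p(3), of y] x by simp
    moreover have "cod.act v b' x = cod.ap (log_slope v y) (b' y)" "dom.act v b x = dom.ap (log_slope v y) (b y)"
      using cod.act_apply [OF p(3), of b' y] dom.act_apply [OF p(3), of b y] x by simp_all
    ultimately show ?thesis
      using True cocycle_identity [of "inv\<^bsub>\<Gamma>'\<^esub> k (- last_one x)" "a x" "b y" "log_slope v y" "- last_one y" "shift w y"] p(2) q(2)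
      by (simp add: p(1) q(1) twist_def dom.QV_mult b'y)
  next
    case False
    have "b' (vinv v x) = \<one>\<^bsub>\<Gamma>'\<^esub>" using b' False p(3) by (auto simp: twist_def q)
    then show ?thesis using False by (simp add: twist_def V_act_def)
  qed
  then have "fst (twist (p \<otimes>\<^bsub>dom.QV\<^esub> q)) = (\<lambda>x. fst (twist p) x \<otimes>\<^bsub>\<Gamma>'\<^esub> cod.act v b' x)" by (rule ext)
  moreover have "snd (twist (p \<otimes>\<^bsub>dom.QV\<^esub> q)) = v \<circ> w"
    by (simp add: twist_def p(1) q(1) dom.QV_mult)
  moreover have "twist p = (fst (twist p), v)" by (simp add: twist_def p)
  then have "twist p \<otimes>\<^bsub>cod.QV\<^esub> twist q = (\<lambda>x. fst (twist p) x \<otimes>\<^bsub>\<Gamma>'\<^esub> cod.act v b' x, v \<circ> w)"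
    using cod.QV_mult [of "fst (twist p)" v b' w] b' by simp
  ultimately show ?thesis by (simp add: prod_eq_iff)
qed

lemma twist_inj: "inj_on twist (carrier dom.QV)"
proof (rule inj_onI)
  fix p q assume pq: "p \<in> carrier dom.QV" "q \<in> carrier dom.QV" "twist p = twist q"
  have fin: "fst p \<in> fin_supp \<Gamma>" "fst q \<in> fin_supp \<Gamma>" using pq by (auto simp: dom.QV_carrier)
  have s: "snd p = snd q" using arg_cong [OF pq(3), of snd] by (simp add: twist_def)
  have "fst p x = fst q x" for x
  proof (cases "x \<in> Q2")
    case True
    have "fst (twist p) x = fst (twist q) x" using pq(3) by simp
    then show ?thesis using True s fin by (simp add: twist_def beta_eq_iff)
  next
    case False
    then show ?thesis using dom.fin_supp_outside [OF fin(1)] dom.fin_supp_outside [OF fin(2)] by simp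
  qed
  then have "fst p = fst q" by (rule ext)
  then show "p = q" using s by (rule prod_eqI)
qed

lemma twist_surj: "carrier cod.QV \<subseteq> twist ` carrier dom.QV"
proof
  fix q assume "q \<in> carrier cod.QV"
  then obtain c v where q: "q = (c, v)" "c \<in> fin_supp \<Gamma>'" "v \<in> thompsonV"
    by (auto simp: cod.QV_carrier)
  \<comment> \<open>The \<beta>-image that the value at \<open>x\<close> must have, found by solving
    the formula of \<open>twist\<close>.\<close>
  define d where "d x = k (- last_one x) \<otimes>\<^bsub>\<Gamma>'\<^esub> c x \<otimes>\<^bsub>\<Gamma>'\<^esub> inv\<^bsub>\<Gamma>'\<^esub> k (shift v x)" for x
  define a where "a x = (if x \<in> Q2 then inv_into (carrier \<Gamma>) \<beta> (d x) else \<one>\<^bsub>\<Gamma>\<^esub>)" for x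
  have d: "d x \<in> carrier \<Gamma>'" for x using q(2) by (simp add: d_def)
  have a: "inv_into (carrier \<Gamma>) \<beta> (d x) \<in> carrier \<Gamma>" "\<beta> (inv_into (carrier \<Gamma>) \<beta> (d x)) = d x" for x
    using d [of x] beta_bij by (simp_all add: bij_betw_def inv_into_into f_inv_into_f)
  have "a \<in> fin_supp \<Gamma>"
  proof (rule dom.fin_suppI)
    have "{x. a x \<noteq> \<one>\<^bsub>\<Gamma>\<^esub>} \<subseteq> {x. c x \<noteq> \<one>\<^bsub>\<Gamma>'\<^esub>} \<union> {x \<in> Q2. shift v x \<noteq> - last_one x}"
    proof
      fix x assume "x \<in> {x. a x \<noteq> \<one>\<^bsub>\<Gamma>\<^esub>}"
      then have x: "x \<in> Q2" "inv_into (carrier \<Gamma>) \<beta> (d x) \<noteq> \<one>\<^bsub>\<Gamma>\<^esub>" by (auto simp: a_def split: if_splits)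
      then have "d x \<noteq> \<one>\<^bsub>\<Gamma>'\<^esub>" using a [of x] beta_one beta_eq_iff by (metis dom.one_closed)
      then show "x \<in> {x. c x \<noteq> \<one>\<^bsub>\<Gamma>'\<^esub>} \<union> {x \<in> Q2. shift v x \<noteq> - last_one x}"
        using x(1) by (auto simp: d_def)
    qed
    then show "finite {x. a x \<noteq> \<one>\<^bsub>\<Gamma>\<^esub>}"
      by (rule finite_subset) (use cod.fin_supp_finite [OF q(2)] finite_shift_defect [OF q(3)] in blast)
  qed (use a in \<open>auto simp: a_def\<close>)
  moreover have "twist (a, v) = q"
  proof -
    have "fst (twist (a, v)) x = c x" for x
    proof (cases "x \<in> Q2")
      case True
      have "inv\<^bsub>\<Gamma>'\<^esub> k (- last_one x) \<otimes>\<^bsub>\<Gamma>'\<^esub> d x \<otimes>\<^bsub>\<Gamma>'\<^esub> k (shift v x) =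
          (inv\<^bsub>\<Gamma>'\<^esub> k (- last_one x) \<otimes>\<^bsub>\<Gamma>'\<^esub> k (- last_one x)) \<otimes>\<^bsub>\<Gamma>'\<^esub> c x \<otimes>\<^bsub>\<Gamma>'\<^esub> (inv\<^bsub>\<Gamma>'\<^esub> k (shift v x) \<otimes>\<^bsub>\<Gamma>'\<^esub> k (shift v x))"
        using q(2) by (simp only: d_def cod.m_assoc cod.m_closed cod.inv_closed k_closed cod.fin_supp_closed)
      then show ?thesis using True a(2) [of x] q(2) by (simp add: twist_def a_def)
    next
      case False
      then show ?thesis using cod.fin_supp_outside [OF q(2)] by (simp add: twist_def)
    qed
    then show ?thesis unfolding q(1) by (intro prod_eqI ext) (simp_all add: twist_def)
  qed
  ultimately show "q \<in> twist ` carrier dom.QV"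
    using q(3) by (intro image_eqI [of _ _ "(a, v)"]) (simp_all add: dom.QV_carrier)
qed

lemma twist_iso: "twist \<in> iso dom.QV cod.QV"
  unfolding iso_def hom_def bij_betw_def
  using twist_closed twist_mult twist_inj twist_surj by auto

end

theorem theoremA:
  fixes \<Gamma> :: "'a monoid" and \<Gamma>' :: "'b monoid"
    and \<alpha> :: "'a \<Rightarrow> 'a" and \<alpha>' :: "'b \<Rightarrow> 'b"
  assumes "group \<Gamma>" and "group \<Gamma>'"
    and "\<alpha> \<in> iso \<Gamma> \<Gamma>" and "\<alpha>' \<in> iso \<Gamma>' \<Gamma>'"
  shows "semidirect_QV \<Gamma> \<alpha> \<cong> semidirect_QV \<Gamma>' \<alpha>' \<longleftrightarrow>
    (\<exists>\<beta> \<in> iso \<Gamma> \<Gamma>'. \<exists>h \<in> carrier \<Gamma>'. \<forall>g \<in> carrier \<Gamma>'.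
        \<alpha>' g = h \<otimes>\<^bsub>\<Gamma>'\<^esub> \<beta> (\<alpha> (inv_into (carrier \<Gamma>) \<beta> g)) \<otimes>\<^bsub>\<Gamma>'\<^esub> inv\<^bsub>\<Gamma>'\<^esub> h)"
    (is "_ \<longleftrightarrow> ?conj")
proof -
  have tw: "twisted_group \<Gamma> \<alpha>" "twisted_group \<Gamma>' \<alpha>'"
    using assms by (simp_all add: twisted_group_def twisted_group_axioms_def)
  show ?thesis
  proof
    assume "semidirect_QV \<Gamma> \<alpha> \<cong> semidirect_QV \<Gamma>' \<alpha>'"
    then obtain \<theta> where "\<theta> \<in> iso (semidirect_QV \<Gamma> \<alpha>) (semidirect_QV \<Gamma>' \<alpha>')"
      by (auto simp: is_iso_def)
    then interpret QV_iso \<Gamma> \<alpha> \<Gamma>' \<alpha>' \<theta>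
      using tw by (simp add: QV_iso_def QV_iso_axioms_def)
    show ?conj by (rule outer_conjugate)
  next
    assume ?conj
    then obtain \<beta> h where beta: "\<beta> \<in> iso \<Gamma> \<Gamma>'" and h: "h \<in> carrier \<Gamma>'"
      and conj: "\<And>g. g \<in> carrier \<Gamma>' \<Longrightarrow>
        \<alpha>' g = h \<otimes>\<^bsub>\<Gamma>'\<^esub> \<beta> (\<alpha> (inv_into (carrier \<Gamma>) \<beta> g)) \<otimes>\<^bsub>\<Gamma>'\<^esub> inv\<^bsub>\<Gamma>'\<^esub> h" by blast
    have bij: "bij_betw \<beta> (carrier \<Gamma>) (carrier \<Gamma>')" using beta by (simp add: iso_def)
    \<comment> \<open>The condition is transported along \<beta> from \<Gamma>' to \<Gamma>, which
      removes \<open>inv_into\<close>.\<close>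
    have "\<alpha>' (\<beta> g) = h \<otimes>\<^bsub>\<Gamma>'\<^esub> \<beta> (\<alpha> g) \<otimes>\<^bsub>\<Gamma>'\<^esub> inv\<^bsub>\<Gamma>'\<^esub> h" if "g \<in> carrier \<Gamma>" for g
      using conj [OF bij_betwE [OF bij, rule_format, OF that]] bij_betw_inv_into_left [OF bij that] by simp
    then interpret outer_conjugate_pair \<Gamma> \<alpha> \<Gamma>' \<alpha>' \<beta> h
      using tw beta h by (simp add: outer_conjugate_pair_def outer_conjugate_pair_axioms_def)
    show "semidirect_QV \<Gamma> \<alpha> \<cong> semidirect_QV \<Gamma>' \<alpha>'"
      using twist_iso by (auto simp: is_iso_def)
  qed
qed

end
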